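(* Let $\Gamma=(X,R)$ be a distance-regular graph with diameter $d\ge 3$ and intersection numbers $a_i$ $(0\le i\le d)$. Then the following are equivalent. (i) $\Gamma$ is tight. (ii) $a_1\ne 0$, $a_d=0$, and $\Gamma$ is 1-homogeneous. (iii) $a_1\ne 0$, $a_d=0$, and $\Gamma$ is 1-homogeneous with respect to at least one edge.
   Context: Graphs are finite, undirected, connected, without loops or multiple edges. For a graph $\Gamma=(X,R)$ with vertex set $X$, edge set $R$, path-length distance $\partial$ and diameter $d=\max\{\partial(x,y): x,y\in X\}$, put $\Gamma_i(x)=\{y\in X:\partial(x,y)=i\}$ and $\Gamma(x)=\Gamma_1(x)$. $\Gamma$ is distance-regular if for all $0\le h,i,j\le d$ and all $x,y\in X$ with $\partial(x,y)=h$ the number $p^h_{ij}=|\Gamma_i(x)\cap\Gamma_j(y)|$ does not depend on $x,y$. Then $c_i=p^i_{1,i-1}$ $(1\le i\le d)$, $a_i=p^i_{1i}$ $(0\le i\le d)$, $b_i=p^i_{1,i+1}$ $(0\le i\le d-1)$, $c_0=0$, $b_d=0$, and $k=b_0$ is the valency. The eigenvalues of $\Gamma$ are the distinct eigenvalues of its adjacency matrix; there are exactly $d+1$ of them, all real, $\theta_0>\theta_1>\cdots>\theta_d$, with $\theta_0=k$. $\Gamma$ is bipartite iff $a_i=0$ for $0\le i\le d$. $\Gamma$ (with $d\ge3$) is tight if it is not bipartite and $\left(\theta_1+\frac{k}{a_1+1}\right)\left(\theta_d+\frac{k}{a_1+1}\right)=-\frac{ka_1b_1}{(a_1+1)^2}$.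 For an edge $xy\in R$ put $D_i^j=D_i^j(x,y)=\Gamma_i(x)\cap\Gamma_j(y)$, so $|D_i^j|=p^1_{ij}$. $\Gamma$ is 1-homogeneous with respect to $xy$ if for all $0\le i,j,r,s\le d$ with $p^1_{ij}\neq0$ and $p^1_{rs}\ne0$, the number $|\Gamma(z)\cap D_r^s|$ is the same for all $z\in D_i^j$. (Equivalently: the span in $\mathbb{R}^X$ of the characteristic vectors of the nonempty sets $D_i^j$ is invariant under the adjacency matrix.) $\Gamma$ is 1-homogeneous if it is 1-homogeneous with respect to every edge. *)

theory Defs
  imports "HOL-Analysis.Analysis"
begin

text \<open>
  A graph with vertex set \<open>UNIV :: 'a set\<close>, \<open>'a\<close> an arbitrary finite type, is
  given by its adjacency relation \<open>R\<close>: an undirected edge \<open>xy\<close> appears as the two pairs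
  \<open>(x, y)\<close> and \<open>(y, x)\<close>.
\<close>

definition connected_graph :: "('a::finite) rel \<Rightarrow> bool" where
  "connected_graph R \<longleftrightarrow> sym R \<and> irrefl R \<and> (\<forall>x y. (x, y) \<in> R\<^sup>*)"

text \<open>
  \<open>R ^^ n\<close> relates the ends of walks of length \<open>n\<close>; a shortest walk is a path.
  All notions below are meant for connected graphs.
\<close>

definition gdist :: "('a::finite) rel \<Rightarrow> 'a \<Rightarrow> 'a \<Rightarrow> nat" where
  "gdist R x y = (LEAST n. (x, y) \<in> R ^^ n)"

definition graph_diameter :: "('a::finite) rel \<Rightarrow> nat" where
  "graph_diameter R = Max {gdist R x y |x y. True}"

definition layer :: "('a::finite) rel \<Rightarrow> nat \<Rightarrow> 'a \<Rightarrow> 'a set" where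
  "layer R i x = {y. gdist R x y = i}"

definition distance_regular :: "('a::finite) rel \<Rightarrow> bool" where
  "distance_regular R \<longleftrightarrow> connected_graph R \<and>
     (\<forall>h\<le>graph_diameter R. \<forall>i\<le>graph_diameter R. \<forall>j\<le>graph_diameter R.
        \<exists>p. \<forall>x y. gdist R x y = h \<longrightarrow> card (layer R i x \<inter> layer R j y) = p)"

text \<open>
  \<open>intersection_number R h i j\<close> is $p^h_{ij}$; in a distance-regular graph the number
  described is unique for \<open>h, i, j\<close> up to the diameter.
\<close>

definition intersection_number :: "('a::finite) rel \<Rightarrow> nat \<Rightarrow> nat \<Rightarrow> nat \<Rightarrow> nat" where
  "intersection_number R h i j =
     (THE p. \<forall>x y. gdist R x y = h \<longrightarrow> card (layer R i x \<inter> layer R j y) = p)"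

definition a_num :: "('a::finite) rel \<Rightarrow> nat \<Rightarrow> nat" where
  "a_num R i = intersection_number R i 1 i"

definition b_num :: "('a::finite) rel \<Rightarrow> nat \<Rightarrow> nat" where
  "b_num R i = (if i < graph_diameter R then intersection_number R i 1 (i + 1) else 0)"

definition valency :: "('a::finite) rel \<Rightarrow> nat" where
  "valency R = b_num R 0"

definition bipartite :: "('a::finite) rel \<Rightarrow> bool" where
  "bipartite R \<longleftrightarrow> (\<forall>i\<le>graph_diameter R. a_num R i = 0)"

definition adjacency_matrix :: "('a::finite) rel \<Rightarrow> real ^ 'a ^ 'a" where
  "adjacency_matrix R = (\<chi> x y. if (x, y) \<in> R then 1 else 0)"

definition graph_eigenvalues :: "('a::finite) rel \<Rightarrow> real set" where
  "graph_eigenvalues R = {t. \<exists>v. v \<noteq> 0 \<and> adjacency_matrix R *v v = t *\<^sub>R v}"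

text \<open>
  The distinct eigenvalues in strictly decreasing order, \<open>theta R 0 > theta R 1 > \<dots>\<close>. The
  adjacency matrix being real symmetric, its real eigenvalues are all its eigenvalues; in a
  distance-regular graph of diameter \<open>d\<close> there are \<open>d + 1\<close> of them, so that
  \<open>theta R d\<close> is the least one.
\<close>

definition theta :: "('a::finite) rel \<Rightarrow> nat \<Rightarrow> real" where
  "theta R i = rev (sorted_list_of_set (graph_eigenvalues R)) ! i"

text \<open>Used only for distance-regular graphs of diameter at least 3.\<close>

definition tight :: "('a::finite) rel \<Rightarrow> bool" where
  "tight R \<longleftrightarrow> \<not> bipartite R \<and>
     (let k = real (valency R); a1 = real (a_num R 1); b1 = real (b_num R 1);
          d = graph_diameter R
      in (theta R 1 + k / (a1 + 1)) * (theta R d + k / (a1 + 1))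
           = - (k * a1 * b1) / (a1 + 1)^2)"

text \<open>\<open>edge_cell R x y i j\<close> is $D_i^j(x,y)$.\<close>

definition edge_cell :: "('a::finite) rel \<Rightarrow> 'a \<Rightarrow> 'a \<Rightarrow> nat \<Rightarrow> nat \<Rightarrow> 'a set" where
  "edge_cell R x y i j = layer R i x \<inter> layer R j y"

definition one_homogeneous_wrt :: "('a::finite) rel \<Rightarrow> 'a \<Rightarrow> 'a \<Rightarrow> bool" where
  "one_homogeneous_wrt R x y \<longleftrightarrow>
     (\<forall>i\<le>graph_diameter R. \<forall>j\<le>graph_diameter R.
      \<forall>r\<le>graph_diameter R. \<forall>s\<le>graph_diameter R.
        intersection_number R 1 i j \<noteq> 0 \<longrightarrow> intersection_number R 1 r s \<noteq> 0 \<longrightarrow>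
        (\<exists>m. \<forall>z\<in>edge_cell R x y i j. card (layer R 1 z \<inter> edge_cell R x y r s) = m))"

definition one_homogeneous :: "('a::finite) rel \<Rightarrow> bool" where
  "one_homogeneous R \<longleftrightarrow> (\<forall>x y. (x, y) \<in> R \<longrightarrow> one_homogeneous_wrt R x y)"

lemma gdist_relpow:
  assumes "connected_graph R"
  shows "(x, y) \<in> R ^^ gdist R x y"
proof -
  have "(x, y) \<in> R\<^sup>*" using assms by (simp add: connected_graph_def)
  then obtain n where "(x, y) \<in> R ^^ n" using rtrancl_imp_relpow by blast
  then show ?thesis unfolding gdist_def by (rule LeastI)
qed

lemma gdist_le: "(x, y) \<in> R ^^ n \<Longrightarrow> gdist R x y \<le> n"
  unfolding gdist_def by (rule Least_le)

lemma gdist_self: "gdist R x x = 0"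
  using gdist_le[where x=x and y=x and R=R and n=0] by simp

lemma gdist_eq_1_iff:
  assumes "connected_graph R"
  shows "gdist R x y = 1 \<longleftrightarrow> (x, y) \<in> R"
proof
  assume "gdist R x y = 1"
  then show "(x, y) \<in> R" using gdist_relpow[OF assms, of x y] by simp
next
  assume xy: "(x, y) \<in> R"
  then have "x \<noteq> y" using assms by (auto simp: connected_graph_def irrefl_def)
  then have "gdist R x y \<noteq> 0" using gdist_relpow[OF assms, of x y] by (metis relpow_0_E)
  moreover have "gdist R x y \<le> 1" using xy gdist_le[where x=x and y=y and R=R and n=1] by simp
  ultimately show "gdist R x y = 1" by simp
qed

lemma gdist_edge_le:
  assumes "connected_graph R" "(y, z) \<in> R"
  shows "gdist R x z \<le> gdist R x y + 1"
  using gdist_le[where x=x and y=z and R=R and n="Suc (gdist R x y)"] gdist_relpow[OF assms(1), of x y] assms(2)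
  by (auto simp: relcomp.simps)

lemma relpow_sym: "sym R \<Longrightarrow> sym (R ^^ n)"
proof (induction n)
  case (Suc n)
  show ?case
  proof (rule symI)
    fix x y assume "(x, y) \<in> R ^^ Suc n"
    then obtain z where "(x, z) \<in> R ^^ n" "(z, y) \<in> R" by auto
    then have "(y, z) \<in> R" "(z, x) \<in> R ^^ n" using Suc by (auto dest: symD)
    then show "(y, x) \<in> R ^^ Suc n" by (rule relpow_Suc_I2)
  qed
qed (simp add: sym_Id)

lemma gdist_commute: "connected_graph R \<Longrightarrow> gdist R x y = gdist R y x"
  by (meson connected_graph_def gdist_le gdist_relpow le_antisym relpow_sym symD)

lemma gdist_le_diameter: "gdist R x y \<le> graph_diameter R"
proof -
  have "{gdist R x y |x y. True} = (\<lambda>(x, y). gdist R x y) ` UNIV" by auto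
  then have "finite {gdist R x y |x y. True}" by simp
  then show ?thesis unfolding graph_diameter_def by (rule Max_ge) auto
qed

lemma intersection_number_eq:
  assumes "distance_regular R" "i \<le> graph_diameter R" "j \<le> graph_diameter R"
  shows "card (layer R i x \<inter> layer R j y) = intersection_number R (gdist R x y) i j"
proof -
  let ?P = "\<lambda>p. \<forall>x' y'. gdist R x' y' = gdist R x y
                  \<longrightarrow> card (layer R i x' \<inter> layer R j y') = p"
  obtain p where p: "?P p"
    using assms gdist_le_diameter[of R x y] unfolding distance_regular_def by metis
  then have "(THE p. ?P p) = p" by (intro the_equality) auto
  with p show ?thesis unfolding intersection_number_def by simp
qed

lemma diameter_attained: "\<exists>x y. gdist R x y = graph_diameter R"
proof -
  have eq: "{gdist R x y |x y. True} = (\<lambda>(x, y). gdist R x y) ` UNIV" by auto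
  then have "finite {gdist R x y |x y. True}" by simp
  then have "Max {gdist R x y |x y. True} \<in> {gdist R x y |x y. True}"
    by (rule Max_in) auto
  then show ?thesis unfolding graph_diameter_def by (smt (verit) mem_Collect_eq)
qed

lemma gdist_attained:
  assumes "connected_graph R" "i \<le> graph_diameter R"
  shows "\<exists>x y. gdist R x y = i"
proof -
  obtain x y where "gdist R x y = graph_diameter R" using diameter_attained by blast
  moreover have "\<exists>z. gdist R x z = i" if "i \<le> gdist R x y" for y
    using that
  proof (induction "gdist R x y" arbitrary: y)
    case 0
    then show ?case by auto
  next
    case (Suc n)
    show ?case
    proof (cases "i = Suc n")
      case True
      then show ?thesis using Suc by auto
    next
      case False
      have "(x, y) \<in> R ^^ Suc n" using gdist_relpow[OF assms(1), of x y] Suc(2) by simp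
      then obtain z where z: "(x, z) \<in> R ^^ n" "(z, y) \<in> R" by auto
      have "gdist R x z = n"
        using gdist_le[OF z(1)] gdist_edge_le[OF assms(1) z(2), of x] Suc(2) by simp
      then show ?thesis using Suc False by auto
    qed
  qed
  ultimately show ?thesis using assms(2) by metis
qed

text \<open>\<open>bipartite\<close> is two-colourability.\<close>

lemma bipartite_iff_two_colourable:
  assumes dr: "distance_regular R"
  shows "bipartite R \<longleftrightarrow> (\<exists>f :: 'a::finite \<Rightarrow> bool. \<forall>(x, y)\<in>R. f x \<noteq> f y)"
proof
  have con: "connected_graph R" using dr by (simp add: distance_regular_def)
  { assume bip: "bipartite R"
    fix u :: 'a
    have "even (gdist R u x) \<noteq> even (gdist R u y)" if xy: "(x, y) \<in> R" for x y
    proof -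
      have yx: "(y, x) \<in> R" using xy con by (auto simp: connected_graph_def dest: symD)
      have "gdist R u x \<noteq> gdist R u y"
      proof
        assume eq: "gdist R u x = gdist R u y"
        define i where "i = gdist R u x"
        have d1: "1 \<le> graph_diameter R"
          using gdist_eq_1_iff[OF con, of x y] xy gdist_le_diameter[of R x y] by simp
        have i: "i \<le> graph_diameter R" unfolding i_def by (rule gdist_le_diameter)
        have "card (layer R 1 x \<inter> layer R i u) = a_num R i"
          using intersection_number_eq[OF dr d1 i, of x u] gdist_commute[OF con, of x u]
          by (simp add: a_num_def i_def)
        then have "layer R 1 x \<inter> layer R i u = {}"
          using bip i by (simp add: bipartite_def)
        moreover have "y \<in> layer R 1 x \<inter> layer R i u"
          using xy eq gdist_eq_1_iff[OF con, of x y] by (simp add: layer_def i_def)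
        ultimately show False by blast
      qed
      then have "gdist R u x = gdist R u y + 1 \<or> gdist R u y = gdist R u x + 1"
        using gdist_edge_le[OF con xy, of u] gdist_edge_le[OF con yx, of u] by linarith
      then show ?thesis by auto
    qed
    then show "\<exists>f :: 'a \<Rightarrow> bool. \<forall>(x, y)\<in>R. f x \<noteq> f y"
      by (intro exI[of _ "\<lambda>x. even (gdist R u x)"]) auto }
  assume "\<exists>f :: 'a \<Rightarrow> bool. \<forall>(x, y)\<in>R. f x \<noteq> f y"
  then obtain f :: "'a \<Rightarrow> bool" where f: "\<And>x y. (x, y) \<in> R \<Longrightarrow> f x \<noteq> f y" by auto
  have walk: "(x, y) \<in> R ^^ n \<Longrightarrow> (f x = f y) = even n" for x y n
    by (induction n arbitrary: y) (auto dest: f)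
  show "bipartite R" unfolding bipartite_def
  proof (intro allI impI)
    fix i assume i: "i \<le> graph_diameter R"
    obtain x u where xu: "gdist R x u = i" using gdist_attained[OF con i] by blast
    have "layer R 1 x \<inter> layer R i u = {}"
    proof (rule ccontr)
      assume "layer R 1 x \<inter> layer R i u \<noteq> {}"
      then obtain y where y: "gdist R x y = 1" "gdist R u y = i" by (auto simp: layer_def)
      have "f x \<noteq> f y" using y f gdist_eq_1_iff[OF con, of x y] by blast
      moreover have "(f x = f u) = even i" "(f u = f y) = even i"
        using walk gdist_relpow[OF con] xu y(2) by metis+
      ultimately show False by auto
    qed
    moreover have "card (layer R 1 x \<inter> layer R i u) = a_num R i"
    proof (cases "1 \<le> graph_diameter R")
      case True
      then show ?thesis using intersection_number_eq[OF dr True i, of x u] xu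
        by (simp add: a_num_def)
    next
      case False
      then have "i = 0" "\<And>x. layer R 1 x = {}"
        using i gdist_le_diameter[of R] by (auto simp: layer_def) (metis not_one_le_zero)
      moreover have "intersection_number R 0 1 0 = 0"
        unfolding intersection_number_def using calculation gdist_self[of R]
        by (intro the_equality) (simp, metis Int_empty_left card.empty)
      ultimately show ?thesis by (simp add: a_num_def)
    qed
    ultimately show "a_num R i = 0" by simp
  qed
qed

end

theory Submission
  imports Defs
begin

text \<open>
  Let \<open>F\<close> be the projection onto the eigenspace of an eigenvalue \<open>t\<close> with \<open>\<bar>t\<bar> < \<kappa>\<close>; without a
  bipartition these are the eigenvalues other than the valency \<open>\<kappa>\<close>. Up to scale the
  entries of \<open>F\<close> are the cosines \<open>\<sigma> (\<partial> x y)\<close>, so that inner products of projected vertices depend on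
  distances only. For an edge \<open>x y\<close> let \<open>w\<close> be the sum of the common neighbours. The Gram
  determinant of \<open>F x\<close>, \<open>F y\<close>, \<open>F w\<close> is nonnegative, and it is zero exactly if \<open>F w\<close> depends
  linearly on \<open>F x\<close> and \<open>F y\<close>. Up to a negative factor it is the polynomial \<open>gram_poly n t\<close>,
  quadratic in \<open>t\<close> with leading coefficient the number \<open>n\<close> of ordered pairs of common neighbours
  at distance two. If a convex quadratic is nonpositive at all these eigenvalues and vanishes at
  two of them, they are the extreme ones \<open>\<theta>\<^sub>1\<close> and \<open>\<theta>\<^sub>d\<close>. Tightness says that it does vanish at both:
  the tightness equation is the value of the product of the zeros in the variable
  \<open>t + \<kappa> / (a\<^sub>1 + 1)\<close> (\<open>tight_imp_gram_poly_eq_0\<close>, \<open>tight_if_two_zeros\<close>). As it does not mention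
  the edge, the zeros for one edge are zeros for all.

  Suppose that it vanishes at two eigenvalues. The two linear dependences, together with the
  total \<open>a\<^sub>1\<close>, are equations for the numbers of common neighbours of \<open>x\<close> and \<open>y\<close> at each distance
  from a third vertex \<open>z\<close>. Because the coefficients of the two dependences differ, they
  determine these numbers by the cell of \<open>z\<close>, show that in the cell at distance \<open>i\<close> from both ends
  some common neighbour is at distance \<open>i - 1\<close>, and rule out a vertex at distance \<open>d\<close> from both
  ends, which is \<open>a\<^sub>d = 0\<close>. Thus every distance matrix maps \<open>w\<close> to a function that is constant on
  cells, and the indicators of all cells can be peeled off from the images of \<open>x\<close>, \<open>y\<close> and \<open>w\<close>
  (\<open>stable_cell_indicators\<close>); so the space of functions constant on cells is invariant, which is
  homogeneity.

  Conversely, let \<open>a\<^sub>1 \<noteq> 0\<close>, \<open>a\<^sub>d = 0\<close> and let one edge be homogeneous. There are at most \<open>3 * d - 1\<close>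
  cells, so in the invariant space of functions constant on cells the \<open>2 * d + 1\<close> dimensions
  spanned by the layers of \<open>x\<close> and \<open>y\<close> leave room for \<open>d - 2\<close> more. Hence \<open>q(A) w\<close> lies in the
  former for some \<open>q \<noteq> 0\<close> of degree at most \<open>d - 2\<close>, \<open>A\<close> being the adjacency matrix
  (\<open>annihilator_of_common_neighbours\<close>). The Gram determinant vanishes at each of the \<open>d\<close>
  nontrivial eigenvalues that is not a root of \<open>q\<close>, so at two of them at least, and \<open>tight_if_two_zeros\<close>
  applies.

  That there are exactly \<open>d + 1\<close> eigenvalues, so that \<open>\<theta>\<^sub>d\<close> is the least one, follows from
  orthogonality of the cosine sequences and from the existence of eigenvectors in every nonzero
  subspace that is invariant under a symmetric operator.
\<close>

section \<open>Symmetric operators on a Euclidean space\<close>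

text \<open>
  A maximiser \<open>v\<close> of the Rayleigh quotient on the invariant subspace is an eigenvector: with
  the maximal value \<open>t\<close> the form \<open>t * (u \<bullet> u) - T u \<bullet> u\<close> is positive semidefinite on the
  subspace and vanishes at \<open>v\<close>, so \<open>v\<close> lies in its radical.
\<close>

lemma invariant_subspace_has_eigenvector:
  fixes T :: "'v::euclidean_space \<Rightarrow> 'v"
  assumes lin: "linear T" and sym: "\<And>u v. T u \<bullet> v = u \<bullet> T v"
    and U: "subspace U" "\<And>u. u \<in> U \<Longrightarrow> T u \<in> U" and w: "w \<in> U" "w \<noteq> 0"
  shows "\<exists>t v. v \<in> U \<and> v \<noteq> 0 \<and> T v = t *\<^sub>R v"
proof -
  let ?S = "U \<inter> sphere 0 1"
  have "compact ?S"
    by (intro closed_Int_compact closed_subspace U compact_sphere)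
  moreover have "w /\<^sub>R norm w \<in> ?S" using w U by (simp add: subspace_scale)
  then have "?S \<noteq> {}" by blast
  moreover have "continuous_on ?S (\<lambda>u. T u \<bullet> u)"
    by (intro continuous_intros linear_continuous_on linear_conv_bounded_linear[THEN iffD1] lin)
  ultimately obtain v where v: "v \<in> ?S" "\<And>u. u \<in> ?S \<Longrightarrow> T u \<bullet> u \<le> T v \<bullet> v"
    using continuous_attains_sup by (metis (no_types, lifting))
  define t where "t = T v \<bullet> v"
  have vv: "v \<bullet> v = 1" "v \<noteq> 0" "v \<in> U" using v(1) by (auto simp: dot_square_norm)
  have psd: "T u \<bullet> u \<le> t * (u \<bullet> u)" if u: "u \<in> U" for u
  proof (cases "u = 0")
    case False
    then have "T (u /\<^sub>R norm u) \<bullet> (u /\<^sub>R norm u) \<le> t"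
      unfolding t_def using u U by (intro v) (simp add: subspace_scale)
    then show ?thesis using False
      by (simp add: linear_scale[OF lin] field_simps dot_square_norm power2_eq_square)
  qed (simp add: linear_0[OF lin])
  define u where "u = t *\<^sub>R v - T v"
  have uU: "u \<in> U" unfolding u_def using vv U by (simp add: subspace_diff subspace_scale)
  have uv: "u \<bullet> v = 0" unfolding u_def t_def using vv by (simp add: inner_diff_left)
  have Tvu: "T v \<bullet> u = - (u \<bullet> u)"
  proof -
    have "T v \<bullet> u = (t *\<^sub>R v - u) \<bullet> u" by (simp add: u_def)
    also have "\<dots> = - (u \<bullet> u)" using uv by (simp add: inner_diff_left inner_diff_right inner_commute)
    finally show ?thesis .
  qed
  define C where "C = t * (u \<bullet> u) - T u \<bullet> u"
  have quad: "0 \<le> 2 * e * (u \<bullet> u) + e\<^sup>2 * C" for e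
  proof -
    have "v + e *\<^sub>R u \<in> U" using uU vv U by (simp add: subspace_add subspace_scale)
    from psd[OF this] have "T v \<bullet> v + 2 * e * (T v \<bullet> u) + e\<^sup>2 * (T u \<bullet> u)
        \<le> t * (v \<bullet> v + e\<^sup>2 * (u \<bullet> u))"
      using uv sym[of u v]
      by (simp add: linear_add[OF lin] linear_scale[OF lin] inner_add_left inner_add_right
          inner_commute algebra_simps power2_eq_square)
    then show ?thesis using Tvu vv unfolding C_def t_def[symmetric]
      by (simp add: algebra_simps)
  qed
  have "u \<bullet> u = 0"
  proof (rule ccontr)
    assume "u \<bullet> u \<noteq> 0"
    then have pos: "u \<bullet> u > 0" by simp
    \<comment> \<open>A small negative multiple of \<open>u\<close> makes the linear term dominate.\<close>
    define e where "e = - (u \<bullet> u) / (\<bar>C\<bar> + 1)"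
    have "e < 0" using pos by (simp add: e_def divide_neg_pos)
    moreover have "\<bar>e * C\<bar> \<le> u \<bullet> u"
      using pos by (simp add: e_def abs_mult field_simps)
    then have "2 * (u \<bullet> u) + e * C > 0" using pos by linarith
    ultimately have "e * (2 * (u \<bullet> u) + e * C) < 0" by (rule mult_neg_pos)
    then show False using quad[of e] by (simp add: algebra_simps power2_eq_square)
  qed
  then have "T v = t *\<^sub>R v" by (simp add: u_def)
  then show ?thesis using vv by blast
qed

definition shifted_product :: "('v::real_vector \<Rightarrow> 'v) \<Rightarrow> real list \<Rightarrow> 'v \<Rightarrow> 'v" where
  "shifted_product T ts v = foldr (\<lambda>t v. T v - t *\<^sub>R v) ts v"

lemma shifted_product_simps [simp]:
  "shifted_product T [] v = v"
  "shifted_product T (t # ts) v = T (shifted_product T ts v) - t *\<^sub>R shifted_product T ts v"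
  by (simp_all add: shifted_product_def)

lemma linear_shifted_product: "linear T \<Longrightarrow> linear (shifted_product T ts)"
proof (induction ts)
  case Nil
  have "shifted_product T [] = id" by (simp add: fun_eq_iff)
  then show ?case by (metis linear_id)
next
  case (Cons t ts)
  have "shifted_product T (t # ts)
      = (\<lambda>v. (T \<circ> shifted_product T ts) v - t *\<^sub>R shifted_product T ts v)"
    by (simp add: fun_eq_iff)
  then show ?case
    using linear_compose_sub[OF linear_compose[OF Cons.IH[OF Cons.prems] Cons.prems]
        linear_compose_scale_right[OF Cons.IH[OF Cons.prems]]] by simp
qed

lemma shifted_product_commute:
  "linear T \<Longrightarrow> shifted_product T ts (T v) = T (shifted_product T ts v)"
  by (induction ts) (simp_all add: linear_diff linear_scale)

lemma shifted_product_symmetric: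
  fixes T :: "'v::real_inner \<Rightarrow> 'v"
  assumes "linear T" "\<And>u v. T u \<bullet> v = u \<bullet> T v"
  shows "shifted_product T ts u \<bullet> v = u \<bullet> shifted_product T ts v"
proof (induction ts arbitrary: u v)
  case (Cons t ts)
  show ?case
    using Cons[of u "T v"] Cons[of u v] assms(2)[of "shifted_product T ts u" v]
      shifted_product_commute[OF assms(1), of ts v]
    by (simp add: inner_diff_left inner_diff_right)
qed simp

lemma shifted_product_eigenvector:
  assumes "linear T" "T v = t *\<^sub>R v" "t \<in> set ts"
  shows "shifted_product T ts v = 0"
  using assms(3)
proof (induction ts)
  case (Cons s ts)
  show ?case
  proof (cases "t \<in> set ts")
    case True
    then show ?thesis using Cons linear_0[OF assms(1)] by simp
  next
    case False
    then have "t = s" using Cons by simp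
    then show ?thesis
      using shifted_product_commute[OF assms(1), of ts v] assms
      by (simp add: linear_scale[OF linear_shifted_product[OF assms(1)]])
  qed
qed simp

text \<open>
  The range of the product is invariant. An eigenvector in it would be killed by the product
  and hence, by symmetry, be orthogonal to the range, that is, to itself.
\<close>

lemma shifted_product_eigenvalues_eq_0:
  fixes T :: "'v::euclidean_space \<Rightarrow> 'v"
  assumes lin: "linear T" and sym: "\<And>u v. T u \<bullet> v = u \<bullet> T v"
    and ts: "\<And>t v. v \<noteq> 0 \<Longrightarrow> T v = t *\<^sub>R v \<Longrightarrow> t \<in> set ts"
  shows "shifted_product T ts v = 0"
proof (rule ccontr)
  let ?q = "shifted_product T ts"
  assume nz: "?q v \<noteq> 0"
  have "\<exists>t v. v \<in> range ?q \<and> v \<noteq> 0 \<and> T v = t *\<^sub>R v"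
  proof (rule invariant_subspace_has_eigenvector[OF lin sym])
    show "subspace (range ?q)"
      by (intro linear_subspace_image linear_shifted_product lin subspace_UNIV)
    show "T u \<in> range ?q" if "u \<in> range ?q" for u
      using that shifted_product_commute[OF lin] by (metis rangeE rangeI)
    show "?q v \<in> range ?q" "?q v \<noteq> 0" using nz by auto
  qed
  then obtain t u where u: "?q u \<noteq> 0" "T (?q u) = t *\<^sub>R ?q u" by blast
  then have "?q (?q u) = 0" using shifted_product_eigenvector[OF lin u(2)] ts by blast
  then have "?q u \<bullet> ?q u = 0" using shifted_product_symmetric[OF lin sym, of ts u "?q u"] by simp
  then show False using u by simp
qed

text \<open>
  Indexing by \<open>I\<close> makes the count insensitive to repetitions: two equal members already give a
  relation.
\<close>

lemma family_dependent_if_card_greater: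
  fixes v :: "'i \<Rightarrow> 'v::real_vector"
  assumes I: "finite I" and S: "finite S" "card S < card I" and v: "\<And>i. i \<in> I \<Longrightarrow> v i \<in> span S"
  obtains c where "\<exists>i\<in>I. c i \<noteq> 0" "(\<Sum>i\<in>I. c i *\<^sub>R v i) = 0"
proof (cases "inj_on v I")
  case True
  have "dependent (v ` I)"
  proof (rule ccontr)
    assume "independent (v ` I)"
    then have "card (v ` I) \<le> card S"
      using independent_span_bound[OF S(1)] v by blast
    then show False using True S by (simp add: card_image)
  qed
  then obtain u w where u: "w \<in> v ` I" "u w \<noteq> 0" "(\<Sum>w\<in>v ` I. u w *\<^sub>R w) = 0"
    using dependent_finite[of "v ` I"] I by auto
  show ?thesis
  proof
    show "\<exists>i\<in>I. (u \<circ> v) i \<noteq> 0" using u by auto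
    show "(\<Sum>i\<in>I. (u \<circ> v) i *\<^sub>R v i) = 0" using u(3) True by (simp add: sum.reindex)
  qed
next
  case False
  then obtain i j where ij: "i \<in> I" "j \<in> I" "i \<noteq> j" "v i = v j" by (auto simp: inj_on_def)
  let ?c = "\<lambda>l. if l = i then 1 else if l = j then - 1 else 0 :: real"
  show ?thesis
  proof
    show "\<exists>l\<in>I. ?c l \<noteq> 0" using ij by auto
    have "(\<Sum>l\<in>I. ?c l *\<^sub>R v l) = (\<Sum>l\<in>{i, j}. ?c l *\<^sub>R v l)"
      using ij I by (intro sum.mono_neutral_right) auto
    then show "(\<Sum>l\<in>I. ?c l *\<^sub>R v l) = 0" using ij by simp
  qed
qed

section \<open>Sums over distance layers\<close>

locale drg =
  fixes R :: "('a::finite) rel"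
  assumes dr: "distance_regular R" and diam: "2 \<le> graph_diameter R"
begin

abbreviation d where "d \<equiv> graph_diameter R"
abbreviation dst (\<open>\<partial>\<close>) where "\<partial> \<equiv> gdist R"
abbreviation p where "p \<equiv> intersection_number R"
abbreviation \<Gamma> where "\<Gamma> \<equiv> layer R"
abbreviation valency_real (\<open>\<kappa>\<close>) where "\<kappa> \<equiv> real (valency R)"
abbreviation a\<^sub>1 where "a\<^sub>1 \<equiv> real (a_num R 1)"
abbreviation b\<^sub>1 where "b\<^sub>1 \<equiv> real (b_num R 1)"

lemma conn: "connected_graph R"
  using dr by (simp add: distance_regular_def)

lemma dist_sym: "\<partial> x y = \<partial> y x"
  by (rule gdist_commute[OF conn])

lemma dist_le [simp]: "\<partial> x y \<le> d"
  by (rule gdist_le_diameter)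

lemma dist_self [simp]: "\<partial> x x = 0"
  by (rule gdist_self)

lemma dist_0_iff [simp]: "\<partial> x y = 0 \<longleftrightarrow> x = y"
  using gdist_relpow[OF conn, of x y] by auto

lemma dist_1_iff: "\<partial> x y = 1 \<longleftrightarrow> (x, y) \<in> R"
  by (rule gdist_eq_1_iff[OF conn])

lemma dist_triangle: "\<partial> x z \<le> \<partial> x y + \<partial> y z"
proof (rule gdist_le)
  show "(x, z) \<in> R ^^ (\<partial> x y + \<partial> y z)"
    unfolding relpow_add by (rule relcompI[OF gdist_relpow[OF conn] gdist_relpow[OF conn]])
qed

lemma dist_adjacent:
  assumes "\<partial> x y = 1"
  shows "\<partial> x z \<le> \<partial> y z + 1" "\<partial> y z \<le> \<partial> x z + 1"
    "\<partial> z x \<le> \<partial> z y + 1" "\<partial> z y \<le> \<partial> z x + 1"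
  using dist_triangle[of x z y] dist_triangle[of y z x] assms
    dist_sym[of x y] dist_sym[of x z] dist_sym[of y z]
  by linarith+

lemma in_layer [simp]: "z \<in> \<Gamma> i x \<longleftrightarrow> \<partial> x z = i"
  by (simp add: layer_def)

lemma layer_0 [simp]: "\<Gamma> 0 x = {x}"
  by auto

lemma layer_beyond_diameter: "d < i \<Longrightarrow> \<Gamma> i x = {}"
  using dist_le by (auto simp: layer_def simp flip: not_le)

lemma card_layer_Int: "i \<le> d \<Longrightarrow> j \<le> d \<Longrightarrow> card (\<Gamma> i x \<inter> \<Gamma> j y) = p (\<partial> x y) i j"
  by (rule intersection_number_eq[OF dr])

lemma card_layer: "i \<le> d \<Longrightarrow> card (\<Gamma> i x) = p 0 i i"
  using card_layer_Int[of i i x x] by simp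

text \<open>Whether a cell is empty depends only on the distances involved, so one witness suffices.\<close>

lemma p_pos_iff:
  assumes "i \<le> d" "j \<le> d"
  shows "0 < p (\<partial> x y) i j \<longleftrightarrow> (\<exists>z. \<partial> x z = i \<and> \<partial> y z = j)"
proof -
  have "0 < card (\<Gamma> i x \<inter> \<Gamma> j y) \<longleftrightarrow> \<Gamma> i x \<inter> \<Gamma> j y \<noteq> {}"
    by (simp add: card_gt_0_iff)
  also have "\<dots> \<longleftrightarrow> (\<exists>z. \<partial> x z = i \<and> \<partial> y z = j)"
    by auto
  finally show ?thesis using card_layer_Int[OF assms, of x y] by simp
qed

lemma vertex_at_distance: "i \<le> d \<Longrightarrow> \<exists>z. \<partial> x z = i"
proof -
  assume i: "i \<le> d"
  obtain u v where "\<partial> u v = i" using gdist_attained[OF conn i] by blast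
  then have "0 < p (\<partial> x x) i i" using p_pos_iff[OF i i, of u u] by auto
  then show ?thesis using p_pos_iff[OF i i, of x x] by auto
qed

lemma step_towards: "\<partial> x z = Suc n \<Longrightarrow> \<exists>y. \<partial> x y = 1 \<and> \<partial> y z = n"
proof -
  assume xz: "\<partial> x z = Suc n"
  then have "(x, z) \<in> R ^^ (1 + n)" using gdist_relpow[OF conn, of x z] by simp
  then obtain y where y: "(x, y) \<in> R" "(y, z) \<in> R ^^ n" unfolding relpow_add by auto
  have "\<partial> x y = 1" using y dist_1_iff by simp
  then show ?thesis using gdist_le[OF y(2)] xz dist_triangle[of x z y] by (intro exI[of _ y]) auto
qed

lemma edge_cell_offdiagonal_nonempty:
  assumes xy: "\<partial> x y = 1" and i: "i < d"
  shows "\<exists>z. \<partial> x z = Suc i \<and> \<partial> y z = i" "\<exists>z. \<partial> x z = i \<and> \<partial> y z = Suc i"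
proof -
  obtain u v where uv: "\<partial> u v = Suc i" using gdist_attained[OF conn, of "Suc i"] i by auto
  then obtain w where w: "\<partial> u w = 1" "\<partial> w v = i" using step_towards by blast
  have "\<exists>z. \<partial> x z = Suc i \<and> \<partial> y z = i" if "\<partial> x y = 1" for x y
    using p_pos_iff[of "Suc i" i u w] p_pos_iff[of "Suc i" i x y] uv w i that by auto
  from this[OF xy] this[of y x] xy dist_sym[of x y]
  show "\<exists>z. \<partial> x z = Suc i \<and> \<partial> y z = i" "\<exists>z. \<partial> x z = i \<and> \<partial> y z = Suc i" by auto
qed

text \<open>The action of the \<open>i\<close>-th distance matrix on functions.\<close>

definition layer_sum :: "nat \<Rightarrow> ('a \<Rightarrow> real) \<Rightarrow> 'a \<Rightarrow> real" where
  "layer_sum i f x = (\<Sum>z\<in>\<Gamma> i x. f z)"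

lemma layer_sum_0 [simp]: "layer_sum 0 f x = f x"
  by (simp add: layer_sum_def)

lemma layer_sum_beyond_diameter: "d < i \<Longrightarrow> layer_sum i f x = 0"
  by (simp add: layer_sum_def layer_beyond_diameter)

lemma layer_sum_linear:
  "layer_sum i (\<lambda>z. f z + g z) x = layer_sum i f x + layer_sum i g x"
  "layer_sum i (\<lambda>z. f z - g z) x = layer_sum i f x - layer_sum i g x"
  "layer_sum i (\<lambda>z. c * f z) x = c * layer_sum i f x"
  "layer_sum i (\<lambda>z. \<Sum>j\<in>J. h j z) x = (\<Sum>j\<in>J. layer_sum i (h j) x)"
  unfolding layer_sum_def
  by (simp_all add: sum.distrib sum_subtractf sum_distrib_left) (rule sum.swap)

lemma sum_by_distance: "(\<Sum>z\<in>UNIV. f z) = (\<Sum>h\<le>d. \<Sum>z\<in>\<Gamma> h x. f z)"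
proof -
  have "(\<Sum>h\<le>d. sum f {z \<in> UNIV. \<partial> x z = h}) = sum f UNIV"
    by (rule sum.group) auto
  then show ?thesis by (simp add: layer_def)
qed

lemma layer_sum_indicator:
  "layer_sum i (\<lambda>z. of_bool (z \<in> S)) x = real (card (\<Gamma> i x \<inter> S))"
  unfolding layer_sum_def by (simp add: of_bool_def sum.If_cases)

lemma layer_sum_layer_sum:
  assumes "i \<le> d" "j \<le> d"
  shows "layer_sum i (layer_sum j f) x = (\<Sum>h\<le>d. real (p h i j) * layer_sum h f x)"
proof -
  have "layer_sum i (layer_sum j f) x
      = (\<Sum>z\<in>\<Gamma> i x. \<Sum>u\<in>UNIV. of_bool (\<partial> z u = j) * f u)"
    unfolding layer_sum_def
    by (intro sum.cong refl sum.mono_neutral_cong_left) auto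
  also have "\<dots> = (\<Sum>u\<in>UNIV. f u * (\<Sum>z\<in>\<Gamma> i x. of_bool (\<partial> z u = j)))"
    by (subst sum.swap) (simp add: sum_distrib_left mult.commute)
  also have "\<dots> = (\<Sum>u\<in>UNIV. f u * real (p (\<partial> x u) i j))"
  proof (intro sum.cong refl)
    fix u
    have "(\<Sum>z\<in>\<Gamma> i x. of_bool (\<partial> z u = j)) = real (card (\<Gamma> i x \<inter> \<Gamma> j u))"
      using layer_sum_indicator[of i "\<Gamma> j u" x]
      by (simp add: layer_sum_def dist_sym[of u])
    then show "f u * (\<Sum>z\<in>\<Gamma> i x. of_bool (\<partial> z u = j)) = f u * real (p (\<partial> x u) i j)"
      using card_layer_Int[OF assms] by simp
  qed
  also have "\<dots> = (\<Sum>h\<le>d. \<Sum>u\<in>\<Gamma> h x. f u * real (p (\<partial> x u) i j))"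
    by (rule sum_by_distance)
  also have "\<dots> = (\<Sum>h\<le>d. real (p h i j) * layer_sum h f x)"
    unfolding layer_sum_def sum_distrib_left by (intro sum.cong) (auto simp: mult.commute)
  finally show ?thesis .
qed

lemma layer_sum_symmetric:
  "(\<Sum>x\<in>UNIV. layer_sum i f x * g x) = (\<Sum>x\<in>UNIV. f x * layer_sum i g x)"
proof -
  have eq: "layer_sum i h x = (\<Sum>z\<in>UNIV. of_bool (\<partial> x z = i) * h z)" for h x
    unfolding layer_sum_def by (intro sum.mono_neutral_cong_left) auto
  have "(\<Sum>x\<in>UNIV. layer_sum i f x * g x)
      = (\<Sum>x\<in>UNIV. \<Sum>z\<in>UNIV. f z * (of_bool (\<partial> z x = i) * g x))"
    unfolding eq sum_distrib_right by (intro sum.cong refl) (simp add: dist_sym)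
  also have "\<dots> = (\<Sum>x\<in>UNIV. f x * layer_sum i g x)"
    unfolding eq sum_distrib_left by (rule sum.swap)
  finally show ?thesis .
qed

section \<open>Eigenfunctions and cosine sequences\<close>

definition eigenfunction :: "real \<Rightarrow> ('a \<Rightarrow> real) \<Rightarrow> bool" where
  "eigenfunction t f \<longleftrightarrow> (\<forall>x. layer_sum 1 f x = t * f x)"

lemma adjacency_mult: "(adjacency_matrix R *v v) $ x = layer_sum 1 (\<lambda>z. v $ z) x"
proof -
  have "(adjacency_matrix R *v v) $ x = (\<Sum>z\<in>UNIV. if (x, z) \<in> R then v $ z else 0)"
    unfolding adjacency_matrix_def matrix_vector_mult_def
    by (auto intro!: sum.cong)
  also have "\<dots> = layer_sum 1 (\<lambda>z. v $ z) x"
    unfolding layer_sum_def by (intro sum.mono_neutral_cong_right) (auto simp: dist_1_iff[simplified])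
  finally show ?thesis .
qed

lemma eigenvalue_iff: "t \<in> graph_eigenvalues R \<longleftrightarrow> (\<exists>f. eigenfunction t f \<and> (\<exists>x. f x \<noteq> 0))"
proof
  assume "t \<in> graph_eigenvalues R"
  then obtain v where v: "v \<noteq> 0" "adjacency_matrix R *v v = t *\<^sub>R v"
    by (auto simp: graph_eigenvalues_def)
  then have "eigenfunction t (\<lambda>z. v $ z)"
    by (simp add: eigenfunction_def del: One_nat_def flip: adjacency_mult)
  moreover have "\<exists>x. v $ x \<noteq> 0" using v by (auto simp: vec_eq_iff)
  ultimately show "\<exists>f. eigenfunction t f \<and> (\<exists>x. f x \<noteq> 0)" by blast
next
  assume "\<exists>f. eigenfunction t f \<and> (\<exists>x. f x \<noteq> 0)"
  then obtain f x where f: "eigenfunction t f" "f x \<noteq> 0" by blast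
  have "adjacency_matrix R *v (\<chi> z. f z) = t *\<^sub>R (\<chi> z. f z)"
    using f by (simp add: vec_eq_iff adjacency_mult eigenfunction_def)
  moreover have "(\<chi> z. f z) \<noteq> 0" using f by (auto simp: vec_eq_iff)
  ultimately show "t \<in> graph_eigenvalues R" unfolding graph_eigenvalues_def by blast
qed

lemma p1_zero: 
  assumes "i < d" "Suc i < h" "h \<le> d"
  shows "p h 1 i = 0"
proof -
  obtain x y where xy: "\<partial> x y = h" using gdist_attained[OF conn] assms by blast
  have "\<not> (\<exists>z. \<partial> x z = 1 \<and> \<partial> y z = i)"
  proof
    assume "\<exists>z. \<partial> x z = 1 \<and> \<partial> y z = i"
    then obtain z where "\<partial> x z = 1" "\<partial> y z = i" by blast
    then show False using dist_triangle[of x y z] xy assms dist_sym[of y z] by simp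
  qed
  then show ?thesis using p_pos_iff[of 1 i x y] xy assms diam by auto
qed

lemma p1_Suc_pos: 
  assumes "i < d"
  shows "0 < p (Suc i) 1 i"
proof -
  obtain x y where xy: "\<partial> x y = Suc i" using gdist_attained[OF conn, of "Suc i"] assms by auto
  then obtain z where "\<partial> x z = 1" "\<partial> z y = i" using step_towards by blast
  then show ?thesis using p_pos_iff[of 1 i x y] assms diam xy dist_sym[of y z] by auto
qed

text \<open>
  Every distance matrix is a polynomial in the adjacency matrix, so it multiplies all
  eigenfunctions for one eigenvalue by the same number.
\<close>

lemma layer_sum_eigenfunction:
  "\<exists>l. \<forall>f. eigenfunction t f \<longrightarrow> (\<forall>x. layer_sum i f x = l * f x)"
proof (induction i rule: less_induct)
  case (less i)
  consider "i = 0" | "d < i" | n where "i = Suc n" "i \<le> d"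
    by (metis leI not0_implies_Suc)
  then show ?case
  proof cases
    case 1
    then show ?thesis by (intro exI[of _ 1]) simp
  next
    case 2
    then show ?thesis by (intro exI[of _ 0]) (simp add: layer_sum_beyond_diameter)
  next
    case 3
    have "\<forall>h\<in>{..n}. \<exists>l. \<forall>f. eigenfunction t f \<longrightarrow> (\<forall>x. layer_sum h f x = l * f x)"
      using less 3 by auto
    then obtain l where
      l: "\<And>h f x. h \<le> n \<Longrightarrow> eigenfunction t f \<Longrightarrow> layer_sum h f x = l h * f x"
      unfolding bchoice_iff by auto
    define c where "c = real (p (Suc n) 1 n)"
    have c: "c \<noteq> 0" using p1_Suc_pos[of n] 3 by (simp add: c_def)
    have "layer_sum i f x = (l n * t - (\<Sum>h\<le>n. real (p h 1 n) * l h)) / c * f x"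
      if f: "eigenfunction t f" for f x
    proof -
      have "layer_sum n f = (\<lambda>z. l n * f z)" using l f by auto
      then have "l n * t * f x = layer_sum 1 (layer_sum n f) x"
        using f by (simp add: layer_sum_linear eigenfunction_def)
      also have "\<dots> = (\<Sum>h\<le>d. real (p h 1 n) * layer_sum h f x)"
        using diam 3 by (intro layer_sum_layer_sum) auto
      also have "\<dots> = (\<Sum>h\<le>Suc n. real (p h 1 n) * layer_sum h f x)"
        using 3 p1_zero[of n] by (intro sum.mono_neutral_right) auto
      also have "\<dots> = (\<Sum>h\<le>n. real (p h 1 n) * l h) * f x + c * layer_sum i f x"
        using l f 3 by (simp add: c_def sum_distrib_right mult.assoc)
      finally show ?thesis using c by (simp add: field_simps)
    qed
    then show ?thesis by blast
  qed
qed

text \<open>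
  The three-term recurrence of the cosines together with its end condition at distance \<open>d\<close>, in
  one equation: the columns of the matrix with entries \<open>\<sigma> (\<partial> z y)\<close> are eigenfunctions.
\<close>

definition cosine_sequence :: "real \<Rightarrow> (nat \<Rightarrow> real) \<Rightarrow> bool" where
  "cosine_sequence t \<sigma> \<longleftrightarrow> \<sigma> 0 = 1 \<and> (\<forall>y. eigenfunction t (\<lambda>z. \<sigma> (\<partial> z y)))"

text \<open>Both sides count the adjacent pairs from the \<open>i\<close>-th to the \<open>h\<close>-th layer of a vertex.\<close>

lemma p_flip:
  assumes "i \<le> d" "h \<le> d"
  shows "p 0 i i * p i 1 h = p 0 h h * p h 1 i"
proof -
  fix u :: 'a
  have "(\<Sum>x\<in>UNIV. layer_sum 1 (\<lambda>z. of_bool (z \<in> \<Gamma> h u)) x * of_bool (x \<in> \<Gamma> i u))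
      = (\<Sum>x\<in>UNIV. of_bool (x \<in> \<Gamma> h u) * layer_sum 1 (\<lambda>z. of_bool (z \<in> \<Gamma> i u)) x)"
    by (rule layer_sum_symmetric)
  moreover have "(\<Sum>x\<in>UNIV. layer_sum 1 (\<lambda>z. of_bool (z \<in> \<Gamma> h u)) x * of_bool (x \<in> \<Gamma> i u))
      = real (p 0 i i * p i 1 h)" if "i \<le> d" "h \<le> d" for i h
  proof -
    have "(\<Sum>x\<in>UNIV. layer_sum 1 (\<lambda>z. of_bool (z \<in> \<Gamma> h u)) x * of_bool (x \<in> \<Gamma> i u))
        = (\<Sum>x\<in>\<Gamma> i u. real (p i 1 h))"
      using that diam card_layer_Int[of 1 h _ u] unfolding layer_sum_indicator
      by (intro sum.mono_neutral_cong_right) (auto simp: dist_sym)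
    then show ?thesis using card_layer[OF that(1)] by simp
  qed
  note this[OF assms] this[OF assms(2) assms(1)]
  ultimately show ?thesis by (simp add: mult.commute flip: of_nat_mult)
qed

text \<open>
  If the \<open>i\<close>-th distance matrix acts as the scalar \<open>l i\<close> on eigenfunctions for \<open>t\<close>, the cosine is
  \<open>l i\<close> divided by the size of the \<open>i\<close>-th layer. Multiplying the distance matrices by the adjacency
  matrix gives the recurrence for \<open>l\<close>, which \<open>p_flip\<close> transposes into that for the cosines.
\<close>

lemma cosine_sequence_exists:
  assumes "t \<in> graph_eigenvalues R"
  shows "\<exists>\<sigma>. cosine_sequence t \<sigma>"
proof -
  obtain f x0 where f: "eigenfunction t f" "f x0 \<noteq> 0" using assms eigenvalue_iff by blast
  have "\<forall>i. \<exists>l. \<forall>x. layer_sum i f x = l * f x" using layer_sum_eigenfunction[of t] f by blast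
  then obtain l where l: "\<And>i x. layer_sum i f x = l i * f x" by metis
  have l0: "l 0 = 1" using l[of 0 x0] f by simp
  have l1: "l 1 = t" using l[of 1 x0] f by (simp add: eigenfunction_def)
  define k where "k i = real (p 0 i i)" for i
  have k: "k i \<noteq> 0" if "i \<le> d" for i
    using p_pos_iff[OF that that, of x0 x0] vertex_at_distance[OF that, of x0] by (simp add: k_def)
  have k0: "k 0 = 1" using card_layer[of 0 x0] by (simp add: k_def)
  have rec: "t * l i = (\<Sum>h\<le>d. real (p h 1 i) * l h)" if "i \<le> d" for i
  proof -
    have li: "layer_sum i f = (\<lambda>z. l i * f z)" using l by auto
    have "t * l i * f x0 = layer_sum 1 (layer_sum i f) x0"
      unfolding li layer_sum_linear l[of 1] l1 by simp
    also have "\<dots> = (\<Sum>h\<le>d. real (p h 1 i) * l h) * f x0"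
      using layer_sum_layer_sum[of 1 i f x0] diam that l
      by (simp add: sum_distrib_right mult.assoc)
    finally show ?thesis using f by simp
  qed
  have "layer_sum 1 (\<lambda>z. l (\<partial> z y) / k (\<partial> z y)) x = t * (l (\<partial> x y) / k (\<partial> x y))" for x y
  proof -
    let ?i = "\<partial> x y"
    have "layer_sum 1 (\<lambda>z. l (\<partial> z y) / k (\<partial> z y)) x
        = (\<Sum>z\<in>UNIV. of_bool (\<partial> x z = 1) * (l (\<partial> y z) / k (\<partial> y z)))"
      unfolding layer_sum_def by (intro sum.mono_neutral_cong_left) (auto simp: dist_sym)
    also have "\<dots> = (\<Sum>h\<le>d. \<Sum>z\<in>\<Gamma> h y. of_bool (\<partial> x z = 1) * (l (\<partial> y z) / k (\<partial> y z)))"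
      by (rule sum_by_distance)
    also have "\<dots> = (\<Sum>h\<le>d. real (p ?i 1 h) * (l h / k h))"
    proof (intro sum.cong refl)
      fix h assume h: "h \<in> {..d}"
      have "(\<Sum>z\<in>\<Gamma> h y. of_bool (\<partial> x z = 1) * (l (\<partial> y z) / k (\<partial> y z)))
          = layer_sum h (\<lambda>z. of_bool (z \<in> \<Gamma> 1 x)) y * (l h / k h)"
        unfolding layer_sum_def sum_distrib_right by (intro sum.cong) auto
      also have "\<dots> = real (p ?i 1 h) * (l h / k h)"
        using card_layer_Int[of 1 h x y] h diam
        unfolding layer_sum_indicator by (simp add: Int_commute)
      finally show "(\<Sum>z\<in>\<Gamma> h y. of_bool (\<partial> x z = 1) * (l (\<partial> y z) / k (\<partial> y z)))
          = real (p ?i 1 h) * (l h / k h)" .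
    qed
    also have "\<dots> = (\<Sum>h\<le>d. real (p h 1 ?i) * l h) / k ?i"
      unfolding sum_divide_distrib
    proof (intro sum.cong refl)
      fix h assume h: "h \<in> {..d}"
      have "k ?i * real (p ?i 1 h) = k h * real (p h 1 ?i)"
        using p_flip[of ?i h] h by (simp add: k_def flip: of_nat_mult)
      then show "real (p ?i 1 h) * (l h / k h) = real (p h 1 ?i) * l h / k ?i"
        using k[of h] k[of ?i] h by (simp add: field_simps)
    qed
    also have "\<dots> = t * (l ?i / k ?i)" using rec[of ?i] by simp
    finally show ?thesis .
  qed
  then have "cosine_sequence t (\<lambda>i. l i / k i)"
    using l0 k0 by (simp add: cosine_sequence_def eigenfunction_def)
  then show ?thesis by blast
qed

text \<open>
  The matrix with entries \<open>\<sigma> (\<partial> x y)\<close> is a positive multiple of the orthogonal projection onto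
  the eigenspace: its columns are eigenfunctions, on which every distance matrix, hence also
  the matrix itself, acts as a scalar.
\<close>

lemma cosine_matrix_square:
  assumes "cosine_sequence t \<sigma>"
  shows "\<exists>n>0. \<forall>x u. (\<Sum>z\<in>UNIV. \<sigma> (\<partial> x z) * \<sigma> (\<partial> z u)) = n * \<sigma> (\<partial> x u)"
proof -
  have "\<forall>i. \<exists>l. \<forall>f. eigenfunction t f \<longrightarrow> (\<forall>x. layer_sum i f x = l * f x)"
    using layer_sum_eigenfunction by blast
  then obtain l where
    l: "\<And>i f x. eigenfunction t f \<Longrightarrow> layer_sum i f x = l i * f x" by metis
  have ls: "layer_sum i (\<lambda>z. \<sigma> (\<partial> z u)) x = l i * \<sigma> (\<partial> x u)" for i u x
    using l assms unfolding cosine_sequence_def by blast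
  have s0: "\<sigma> 0 = 1" using assms by (simp add: cosine_sequence_def)
  define n where "n = (\<Sum>i\<le>d. \<sigma> i * l i)"
  have sq: "(\<Sum>z\<in>UNIV. \<sigma> (\<partial> x z) * \<sigma> (\<partial> z u)) = n * \<sigma> (\<partial> x u)" for x u
  proof -
    have "(\<Sum>z\<in>UNIV. \<sigma> (\<partial> x z) * \<sigma> (\<partial> z u))
        = (\<Sum>h\<le>d. \<Sum>z\<in>\<Gamma> h x. \<sigma> (\<partial> x z) * \<sigma> (\<partial> z u))" by (rule sum_by_distance)
    also have "\<dots> = (\<Sum>h\<le>d. \<sigma> h * layer_sum h (\<lambda>z. \<sigma> (\<partial> z u)) x)"
      unfolding layer_sum_def sum_distrib_left by (intro sum.cong) auto
    also have "\<dots> = n * \<sigma> (\<partial> x u)"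
      unfolding ls n_def sum_distrib_right by (simp add: mult.assoc)
    finally show ?thesis .
  qed
  fix x :: 'a
  have "n = (\<Sum>z\<in>UNIV. \<sigma> (\<partial> x z) * \<sigma> (\<partial> z x))" using sq[of x x] s0 by simp
  also have "\<dots> = (\<Sum>z\<in>UNIV. (\<sigma> (\<partial> x z))\<^sup>2)"
    by (intro sum.cong refl) (simp add: dist_sym power2_eq_square)
  also have "\<dots> \<ge> (\<sigma> (\<partial> x x))\<^sup>2"
    by (intro member_le_sum) auto
  finally have "n > 0" using s0 by simp
  with sq show ?thesis by blast
qed

lemma cosine_form:
  assumes "cosine_sequence t \<sigma>"
  shows cosine_form_nonneg: "0 \<le> (\<Sum>x\<in>UNIV. \<Sum>y\<in>UNIV. c x * c y * \<sigma> (\<partial> x y))"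
    and cosine_form_radical: "(\<Sum>x\<in>UNIV. \<Sum>y\<in>UNIV. c x * c y * \<sigma> (\<partial> x y)) = 0
      \<Longrightarrow> (\<Sum>x\<in>UNIV. c x * \<sigma> (\<partial> x z)) = 0"
proof -
  let ?Q = "\<Sum>x\<in>UNIV. \<Sum>y\<in>UNIV. c x * c y * \<sigma> (\<partial> x y)"
  obtain n where n: "n > 0" "\<And>x u. (\<Sum>z\<in>UNIV. \<sigma> (\<partial> x z) * \<sigma> (\<partial> z u)) = n * \<sigma> (\<partial> x u)"
    using cosine_matrix_square[OF assms] by blast
  have "(\<Sum>z\<in>UNIV. (\<Sum>x\<in>UNIV. c x * \<sigma> (\<partial> x z))\<^sup>2)
      = (\<Sum>z\<in>UNIV. \<Sum>x\<in>UNIV. \<Sum>y\<in>UNIV. c x * c y * (\<sigma> (\<partial> x z) * \<sigma> (\<partial> z y)))"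
    unfolding power2_eq_square sum_product
    by (intro sum.cong refl) (simp add: dist_sym mult.commute mult.left_commute)
  also have "\<dots> = (\<Sum>x\<in>UNIV. \<Sum>z\<in>UNIV. \<Sum>y\<in>UNIV. c x * c y * (\<sigma> (\<partial> x z) * \<sigma> (\<partial> z y)))"
    by (rule sum.swap)
  also have "\<dots> = (\<Sum>x\<in>UNIV. \<Sum>y\<in>UNIV. \<Sum>z\<in>UNIV. c x * c y * (\<sigma> (\<partial> x z) * \<sigma> (\<partial> z y)))"
    by (intro sum.cong refl sum.swap)
  also have "\<dots> = n * ?Q"
    unfolding sum_distrib_left[symmetric] n(2) by (simp add: sum_distrib_left mult_ac)
  finally have eq: "(\<Sum>z\<in>UNIV. (\<Sum>x\<in>UNIV. c x * \<sigma> (\<partial> x z))\<^sup>2) = n * ?Q" .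
  have "0 \<le> n * ?Q" unfolding eq[symmetric] by (intro sum_nonneg) auto
  then show "0 \<le> ?Q" using n by (simp add: zero_le_mult_iff)
  assume "?Q = 0"
  then have "(\<Sum>z\<in>UNIV. (\<Sum>x\<in>UNIV. c x * \<sigma> (\<partial> x z))\<^sup>2) = 0" using eq by simp
  then show "(\<Sum>x\<in>UNIV. c x * \<sigma> (\<partial> x z)) = 0"
    by (subst (asm) sum_nonneg_eq_0_iff) auto
qed

end

section \<open>The number of eigenvalues and their range\<close>

context drg
begin

lemma eigenfunctions_orthogonal:
  assumes "eigenfunction s f" "eigenfunction t g" "s \<noteq> t"
  shows "(\<Sum>x\<in>UNIV. f x * g x) = 0"
proof -
  have "s * (\<Sum>x\<in>UNIV. f x * g x) = t * (\<Sum>x\<in>UNIV. f x * g x)"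
    using layer_sum_symmetric[of 1 f g] assms
    by (simp add: eigenfunction_def sum_distrib_left mult_ac)
  then show ?thesis using assms by simp
qed

text \<open>
  The cosine sequences, read as functions of the distance to a fixed vertex, are orthogonal
  and lie in the span of the \<open>d + 1\<close> indicators of its layers.
\<close>

lemma eigenvalues_at_most:
  "finite (graph_eigenvalues R)" "card (graph_eigenvalues R) \<le> d + 1"
proof -
  fix x :: 'a
  obtain \<sigma> where \<sigma>: "\<And>t. t \<in> graph_eigenvalues R \<Longrightarrow> cosine_sequence t (\<sigma> t)"
    using cosine_sequence_exists by metis
  define V :: "real \<Rightarrow> real ^ 'a" where "V t = (\<chi> z. \<sigma> t (\<partial> z x))" for t
  define B :: "(real ^ 'a) set" where "B = (\<lambda>h. \<chi> z. of_bool (\<partial> z x = h)) ` {..d}"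
  have B: "finite B" "card B \<le> d + 1"
    unfolding B_def using card_image_le[of "{..d}"] by auto
  have span: "V t \<in> span B" for t
  proof -
    have "V t = (\<Sum>h\<le>d. \<sigma> t h *\<^sub>R (\<chi> z. of_bool (\<partial> z x = h)))"
      unfolding vec_eq_iff V_def
      by (simp add: of_bool_def if_distrib[of "\<lambda>u. _ * u"] sum.delta cong: if_cong)
    then show ?thesis
      by (metis (no_types, lifting) B_def imageI span_base span_scale span_sum)
  qed
  have orth: "V s \<bullet> V t = 0"
    if "s \<in> graph_eigenvalues R" "t \<in> graph_eigenvalues R" "s \<noteq> t" for s t
    using eigenfunctions_orthogonal \<sigma> that
    unfolding V_def cosine_sequence_def inner_vec_def by simp blast
  have nz: "V t \<noteq> 0" if "t \<in> graph_eigenvalues R" for t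
    using \<sigma>[OF that] unfolding V_def cosine_sequence_def vec_eq_iff
    by (metis dist_self vec_lambda_beta zero_index zero_neq_one)
  have "card F \<le> d + 1" if F: "F \<subseteq> graph_eigenvalues R" "finite F" for F
  proof -
    have "inj_on V F"
      by (metis (no_types, lifting) F(1) inj_onI inner_eq_zero_iff nz orth subset_iff)
    moreover have "independent (V ` F)"
    proof (rule pairwise_orthogonal_independent)
      show "pairwise orthogonal (V ` F)"
        using orth F unfolding pairwise_def orthogonal_def by blast
      show "0 \<notin> V ` F" using nz F by auto
    qed
    then have "card (V ` F) \<le> card B"
      using independent_span_bound[OF B(1)] span by blast
    ultimately show ?thesis using B by (simp add: card_image)
  qed
  then show "finite (graph_eigenvalues R)" "card (graph_eigenvalues R) \<le> d + 1"
    using finite_if_finite_subsets_card_bdd by (blast, blast)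
qed

text \<open>
  Each factor extends the support by one step; the diagonal shifts do not reach the new layer.
\<close>

lemma shifted_product_at_distance:
  fixes x :: 'a and ts :: "real list"
  defines "w \<equiv> shifted_product (\<lambda>v. adjacency_matrix R *v v) ts (axis x 1)"
  shows "length ts < \<partial> x z \<Longrightarrow> w $ z = 0" "\<partial> x z = length ts \<Longrightarrow> 0 < w $ z"
proof -
  let ?T = "\<lambda>v. adjacency_matrix R *v v"
  have "(length ts < \<partial> x z \<longrightarrow> shifted_product ?T ts (axis x 1) $ z = 0) \<and>
    (\<partial> x z = length ts \<longrightarrow> 0 < shifted_product ?T ts (axis x 1) $ z)"
  proof (induction ts arbitrary: z)
    case Nil
    then show ?case by (auto simp: axis_def)
  next
    case (Cons t ts)
    let ?w = "shifted_product ?T ts (axis x 1)"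
    have w: "shifted_product ?T (t # ts) (axis x 1) $ z
        = (\<Sum>u\<in>\<Gamma> 1 z. ?w $ u) - t * ?w $ z"
      using adjacency_mult[of ?w z] by (simp add: layer_sum_def)
    show ?case
    proof (intro conjI impI)
      assume far: "length (t # ts) < \<partial> x z"
      have "?w $ u = 0" if "u \<in> \<Gamma> 1 z" for u
        using far that dist_adjacent(3)[of z u x] Cons[of u] by simp
      then show "shifted_product ?T (t # ts) (axis x 1) $ z = 0"
        using far Cons[of z] unfolding w by simp
    next
      assume eq: "\<partial> x z = length (t # ts)"
      obtain v where v: "\<partial> z v = 1" "\<partial> v x = length ts"
        using step_towards[of z x "length ts"] eq dist_sym[of x z] by auto
      have "0 \<le> ?w $ u" if "u \<in> \<Gamma> 1 z" for u
        using eq that dist_adjacent(3)[of z u x] Cons[of u] by (cases "\<partial> x u = length ts") auto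
      then have "?w $ v \<le> (\<Sum>u\<in>\<Gamma> 1 z. ?w $ u)"
        using v by (intro member_le_sum) auto
      moreover have "0 < ?w $ v" using Cons[of v] v dist_sym[of x v] by simp
      ultimately show "0 < shifted_product ?T (t # ts) (axis x 1) $ z"
        using eq Cons[of z] unfolding w by simp
    qed
  qed
  then show "length ts < \<partial> x z \<Longrightarrow> w $ z = 0" "\<partial> x z = length ts \<Longrightarrow> 0 < w $ z"
    unfolding w_def by auto
qed

text \<open>
  With at most \<open>d\<close> eigenvalues, the product of the corresponding shifts of the adjacency matrix
  would vanish; but its entry at two vertices whose distance is the number of factors counts the
  shortest paths between them.
\<close>

lemma card_eigenvalues: "card (graph_eigenvalues R) = d + 1"
proof (rule ccontr)
  let ?A = "adjacency_matrix R"
  assume "card (graph_eigenvalues R) \<noteq> d + 1"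
  then have less: "card (graph_eigenvalues R) \<le> d" using eigenvalues_at_most by simp
  obtain ts where ts: "set ts = graph_eigenvalues R" "length ts = card (graph_eigenvalues R)"
    using finite_distinct_list[OF eigenvalues_at_most(1)] distinct_card by metis
  fix x :: 'a
  obtain z where z: "\<partial> x z = length ts" using vertex_at_distance less ts by metis
  have "shifted_product (\<lambda>v. ?A *v v) ts (axis x 1) = 0"
  proof (rule shifted_product_eigenvalues_eq_0)
    show "linear ((*v) ?A)" by (rule matrix_vector_mul_linear)
    show "(?A *v u) \<bullet> v = u \<bullet> (?A *v v)" for u v
      using layer_sum_symmetric[of 1 "($) u" "($) v"]
      by (simp add: inner_vec_def adjacency_mult)
    show "t \<in> set ts" if "v \<noteq> 0" "?A *v v = t *\<^sub>R v" for t v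
      unfolding ts graph_eigenvalues_def using that by blast
  qed
  then show False using shifted_product_at_distance(2)[OF z] by simp
qed

lemma valency_eq: "\<kappa> = real (card (\<Gamma> 1 x))"
  using card_layer[of 1 x] diam by (simp add: valency_def b_num_def)

lemma valency_pos: "0 < \<kappa>"
proof -
  fix x :: 'a
  have "\<Gamma> 1 x \<noteq> {}" using vertex_at_distance[of 1 x] diam by auto
  then show ?thesis unfolding valency_eq[of x] by (simp add: card_gt_0_iff)
qed

lemma b1_pos: "0 < b\<^sub>1"
proof -
  obtain u v where uv: "\<partial> u v = 2" using gdist_attained[OF conn diam] by blast
  then obtain w where w: "\<partial> u w = 1" "\<partial> w v = 1" using step_towards[of u v 1] by auto
  then have "0 < p (\<partial> w u) 1 2" using p_pos_iff[of 1 2 w u] uv diam by auto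
  then show ?thesis using w diam dist_sym[of w u] by (simp add: b_num_def numeral_2_eq_2)
qed

lemma valency_is_eigenvalue: "\<kappa> \<in> graph_eigenvalues R"
  unfolding eigenvalue_iff eigenfunction_def
  by (rule exI[of _ "\<lambda>_. 1"]) (use valency_eq in \<open>simp add: layer_sum_def\<close>)

lemma edge_neighbourhoods:
  assumes "\<partial> x y = 1"
  shows card_common_neighbours: "card (\<Gamma> 1 x \<inter> \<Gamma> 1 y) = a\<^sub>1"
    and card_one_sided_neighbours: "card (\<Gamma> 1 x \<inter> \<Gamma> 2 y) = b\<^sub>1"
    and neighbours_split: "\<Gamma> 1 x = {y} \<union> (\<Gamma> 1 x \<inter> \<Gamma> 1 y) \<union> (\<Gamma> 1 x \<inter> \<Gamma> 2 y)"
proof -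
  show "card (\<Gamma> 1 x \<inter> \<Gamma> 1 y) = a\<^sub>1" "card (\<Gamma> 1 x \<inter> \<Gamma> 2 y) = b\<^sub>1"
    using card_layer_Int[of 1 1 x y] card_layer_Int[of 1 2 x y] assms diam
    by (auto simp: a_num_def b_num_def numeral_2_eq_2)
  have "\<partial> y z = 0 \<or> \<partial> y z = 1 \<or> \<partial> y z = 2" if "\<partial> x z = 1" for z
    using dist_adjacent(2)[OF assms, of z] that by linarith
  then show "\<Gamma> 1 x = {y} \<union> (\<Gamma> 1 x \<inter> \<Gamma> 1 y) \<union> (\<Gamma> 1 x \<inter> \<Gamma> 2 y)"
    using assms by (auto simp: set_eq_iff)
qed

lemma sum_neighbours:
  fixes f :: "'a \<Rightarrow> real"
  assumes "\<partial> x y = 1"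
  shows "(\<Sum>z\<in>\<Gamma> 1 x. f z) = f y + (\<Sum>z\<in>\<Gamma> 1 x \<inter> \<Gamma> 1 y. f z) + (\<Sum>z\<in>\<Gamma> 1 x \<inter> \<Gamma> 2 y. f z)"
proof -
  have "(\<Sum>z\<in>\<Gamma> 1 x. f z) = sum f ({y} \<union> (\<Gamma> 1 x \<inter> \<Gamma> 1 y) \<union> (\<Gamma> 1 x \<inter> \<Gamma> 2 y))"
    using neighbours_split[OF assms] by (rule arg_cong)
  also have "\<dots> = f y + (\<Sum>z\<in>\<Gamma> 1 x \<inter> \<Gamma> 1 y. f z) + (\<Sum>z\<in>\<Gamma> 1 x \<inter> \<Gamma> 2 y. f z)"
    by (subst sum.union_disjoint, auto)+
  finally show ?thesis .
qed

lemma edge_exists: "\<exists>x y. \<partial> x y = 1"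
  using gdist_attained[OF conn, of 1] diam by auto

lemma valency_split: "\<kappa> = 1 + a\<^sub>1 + b\<^sub>1"
proof -
  obtain x y where xy: "\<partial> x y = 1" using edge_exists by blast
  show ?thesis
    using sum_neighbours[OF xy, of "\<lambda>_. 1"] valency_eq[of x]
      card_common_neighbours[OF xy] card_one_sided_neighbours[OF xy] by simp
qed

lemma cosine_1_2:
  assumes "cosine_sequence t \<sigma>"
  shows cosine_0: "\<sigma> 0 = 1"
    and cosine_1: "\<kappa> * \<sigma> 1 = t"
    and cosine_2: "1 + a\<^sub>1 * \<sigma> 1 + b\<^sub>1 * \<sigma> 2 = t * \<sigma> 1"
proof -
  obtain x y where xy: "\<partial> x y = 1" using edge_exists by blast
  show s0: "\<sigma> 0 = 1" using assms by (simp add: cosine_sequence_def)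
  have ls: "(\<Sum>z\<in>\<Gamma> 1 x. \<sigma> (\<partial> z u)) = t * \<sigma> (\<partial> x u)" for u
    using assms by (simp add: cosine_sequence_def eigenfunction_def layer_sum_def)
  have "(\<Sum>z\<in>\<Gamma> 1 x. \<sigma> (\<partial> z x)) = \<kappa> * \<sigma> 1"
    unfolding valency_eq[of x] by (subst sum_constant[symmetric], intro sum.cong) (auto simp: dist_sym)
  then show "\<kappa> * \<sigma> 1 = t" using ls[of x] s0 by simp
  have "(\<Sum>z\<in>\<Gamma> 1 x \<inter> \<Gamma> j y. \<sigma> (\<partial> z y)) = real (card (\<Gamma> 1 x \<inter> \<Gamma> j y)) * \<sigma> j" for j
    by (subst sum_constant[symmetric], intro sum.cong) (auto simp: dist_sym)
  then show "1 + a\<^sub>1 * \<sigma> 1 + b\<^sub>1 * \<sigma> 2 = t * \<sigma> 1"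
    using sum_neighbours[OF xy, of "\<lambda>z. \<sigma> (\<partial> z y)"] ls[of y] s0 xy
      card_common_neighbours[OF xy] card_one_sided_neighbours[OF xy] by simp
qed

text \<open>The cosine form at \<open>x + y\<close> and \<open>x - y\<close>.\<close>

lemma cosine_form_edge:
  assumes c: "cosine_sequence t \<sigma>" and xy: "\<partial> x y = 1" and e: "e = 1 \<or> e = - 1"
  shows "0 \<le> 1 + e * \<sigma> 1"
    and "1 + e * \<sigma> 1 = 0 \<Longrightarrow> \<sigma> (\<partial> x z) + e * \<sigma> (\<partial> y z) = 0"
proof -
  define c where "c u = of_bool (u = x) + e * of_bool (u = y)" for u :: 'a
  have app: "(\<Sum>u\<in>UNIV. c u * h u) = h x + e * h y" for h :: "'a \<Rightarrow> real"
    unfolding c_def by (simp add: distrib_right sum.distrib of_bool_def sum.delta mult.assoc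
        flip: sum_distrib_left)
       (simp add: if_distrib[of "\<lambda>u. u * _"] cong: if_cong)
  have "(\<Sum>v\<in>UNIV. c u * c v * \<sigma> (\<partial> u v)) = c u * (\<sigma> (\<partial> u x) + e * \<sigma> (\<partial> u y))" for u
    using app[of "\<lambda>v. \<sigma> (\<partial> u v)"] by (simp add: mult.assoc flip: sum_distrib_left)
  then have "(\<Sum>u\<in>UNIV. \<Sum>v\<in>UNIV. c u * c v * \<sigma> (\<partial> u v))
      = (\<Sum>u\<in>UNIV. c u * (\<sigma> (\<partial> u x) + e * \<sigma> (\<partial> u y)))" by simp
  also have "\<dots> = 2 * (1 + e * \<sigma> 1)"
    unfolding app using xy dist_sym[of y x] cosine_0[OF \<open>cosine_sequence t \<sigma>\<close>] e by auto
  finally have Q: "(\<Sum>u\<in>UNIV. \<Sum>v\<in>UNIV. c u * c v * \<sigma> (\<partial> u v)) = 2 * (1 + e * \<sigma> 1)" .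
  show "0 \<le> 1 + e * \<sigma> 1"
    using cosine_form_nonneg[OF \<open>cosine_sequence t \<sigma>\<close>, of c] Q by simp
  show "\<sigma> (\<partial> x z) + e * \<sigma> (\<partial> y z) = 0" if "1 + e * \<sigma> 1 = 0"
    using cosine_form_radical[OF \<open>cosine_sequence t \<sigma>\<close>, of c z] Q that app by simp
qed

lemma abs_eigenvalue_le:
  assumes "t \<in> graph_eigenvalues R"
  shows "\<bar>t\<bar> \<le> \<kappa>"
proof -
  obtain \<sigma> where \<sigma>: "cosine_sequence t \<sigma>" using cosine_sequence_exists assms by blast
  obtain x y where xy: "\<partial> x y = 1" using edge_exists by blast
  have "0 \<le> 1 + \<sigma> 1" "0 \<le> 1 - \<sigma> 1"
    using cosine_form_edge(1)[OF \<sigma> xy, of 1] cosine_form_edge(1)[OF \<sigma> xy, of "-1"] by auto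
  then have "0 \<le> \<kappa> * (1 + \<sigma> 1)" "0 \<le> \<kappa> * (1 - \<sigma> 1)" by simp_all
  then show ?thesis using cosine_1[OF \<sigma>] by (simp add: algebra_simps abs_le_iff)
qed

text \<open>
  The cosine sequence of \<open>- \<kappa>\<close> alternates between \<open>1\<close> and \<open>- 1\<close>, so that no edge joins two
  vertices at the same distance from a third.
\<close>

lemma bipartite_if_minus_valency:
  assumes "- \<kappa> \<in> graph_eigenvalues R"
  shows "bipartite R"
proof -
  obtain \<sigma> where \<sigma>: "cosine_sequence (- \<kappa>) \<sigma>" using cosine_sequence_exists assms by blast
  have s1: "\<sigma> 1 = - 1" using cosine_1[OF \<sigma>] valency_pos
    by (metis less_irrefl mult_cancel_left mult_minus1_right)
  have flip: "\<sigma> (\<partial> x z) = - \<sigma> (\<partial> y z)" if "\<partial> x y = 1" for x y z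
    using cosine_form_edge(2)[OF \<sigma> that, of 1 z] s1 by simp
  have nz: "i \<le> d \<Longrightarrow> \<sigma> i \<noteq> 0" for i
  proof (induction i)
    case 0
    then show ?case using cosine_0[OF \<sigma>] by simp
  next
    case (Suc i)
    then obtain x z where xz: "\<partial> x z = Suc i" using gdist_attained[OF conn] by blast
    then obtain y where "\<partial> x y = 1" "\<partial> y z = i" using step_towards by blast
    then show ?case using flip[of x y z] xz Suc by simp
  qed
  show ?thesis unfolding bipartite_def
  proof (intro allI impI)
    fix i assume i: "i \<le> d"
    obtain x z where xz: "\<partial> x z = i" using gdist_attained[OF conn i] by blast
    have "\<not> (\<exists>y. \<partial> x y = 1 \<and> \<partial> z y = i)"
      using flip[of x _ z] nz[OF i] xz dist_sym[of z] by (metis neg_equal_zero)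
    then show "a_num R i = 0"
      using p_pos_iff[of 1 i x z] i diam xz by (auto simp: a_num_def)
  qed
qed

lemma theta_1_and_d:
  shows theta_1_eigenvalue: "theta R 1 \<in> graph_eigenvalues R"
    and theta_d_eigenvalue: "theta R d \<in> graph_eigenvalues R"
    and theta_1_less: "theta R 1 < \<kappa>"
    and theta_d_less: "theta R d < theta R 1"
    and theta_d_le: "t \<in> graph_eigenvalues R \<Longrightarrow> theta R d \<le> t"
    and theta_1_ge: "t \<in> graph_eigenvalues R \<Longrightarrow> t \<noteq> \<kappa> \<Longrightarrow> t \<le> theta R 1"
proof -
  define xs where "xs = sorted_list_of_set (graph_eigenvalues R)"
  have xs: "sorted_wrt (<) xs" "set xs = graph_eigenvalues R" "length xs = d + 1"
    unfolding xs_def using eigenvalues_at_most(1) card_eigenvalues by auto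
  have th: "theta R i = xs ! (d - i)" if "i \<le> d" for i
    unfolding theta_def xs_def[symmetric] using that xs(3) by (simp add: rev_nth)
  have mem: "xs ! i \<in> graph_eigenvalues R" if "i \<le> d" for i
    using that xs(2,3) nth_mem[of i xs] by simp
  have less: "xs ! i < xs ! j" if "i < j" "j \<le> d" for i j
    using sorted_wrt_nth_less[OF xs(1), of i j] that xs(3) by simp
  have ex: "\<exists>i\<le>d. t = xs ! i" if "t \<in> graph_eigenvalues R" for t
    using that xs(2,3) by (metis Suc_eq_plus1 in_set_conv_nth less_Suc_eq_le)
  have top: "xs ! d = \<kappa>"
  proof -
    obtain i where i: "i \<le> d" "\<kappa> = xs ! i" using ex valency_is_eigenvalue by blast
    have "xs ! d \<le> \<kappa>" using abs_eigenvalue_le[OF mem[of d]] by simp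
    then show ?thesis using less[of i d] i by (cases "i = d") auto
  qed
  show "theta R 1 \<in> graph_eigenvalues R" "theta R d \<in> graph_eigenvalues R"
    using th mem diam by auto
  show "theta R 1 < \<kappa>" unfolding top[symmetric] using th[of 1] less diam by simp
  show "theta R d < theta R 1" using th[of 1] th[of d] less diam by simp
  show "theta R d \<le> t" if t: "t \<in> graph_eigenvalues R"
  proof -
    obtain i where i: "i \<le> d" "t = xs ! i" using ex t by blast
    have "xs ! 0 \<le> xs ! i"
    proof (cases "i = 0")
      case False
      then show ?thesis using less[of 0 i] i(1) by simp
    qed simp
    then show ?thesis unfolding i(2) th[OF order_refl] by simp
  qed
  show "t \<le> theta R 1" if t: "t \<in> graph_eigenvalues R" "t \<noteq> \<kappa>"
  proof -
    obtain i where i: "i \<le> d" "t = xs ! i" using ex t by blast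
    then have "i \<le> d - 1" using top t by (cases "i = d") auto
    then show ?thesis using th[of 1] less[of i "d - 1"] i diam
      by (cases "i = d - 1") auto
  qed
qed

section \<open>The Gram determinant of an edge\<close>

definition far_pairs :: "'a \<Rightarrow> 'a \<Rightarrow> real" where
  "far_pairs x y =
     real (card {(u, v). u \<in> \<Gamma> 1 x \<inter> \<Gamma> 1 y \<and> v \<in> \<Gamma> 1 x \<inter> \<Gamma> 1 y \<and> \<partial> u v = 2})"

text \<open>
  Up to a factor that is positive for \<open>\<bar>t\<bar> < \<kappa>\<close>, the Gram determinant of the projections of
  \<open>x\<close>, \<open>y\<close> and the sum of the common neighbours of \<open>x\<close> and \<open>y\<close> onto the eigenspace of \<open>t\<close> is
  \<open>- gram_poly (far_pairs x y) t\<close>; see \<open>gram_identity\<close>.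
\<close>

definition gram_poly :: "real \<Rightarrow> real \<Rightarrow> real" where
  "gram_poly n t = n * (t + \<kappa>) * (t + 1) - a\<^sub>1 * b\<^sub>1 * ((a\<^sub>1 + 1) * t + \<kappa>)"

lemma sum_common_neighbours:
  fixes \<sigma> :: "nat \<Rightarrow> real"
  assumes xy: "\<partial> x y = 1"
  defines "D \<equiv> \<Gamma> 1 x \<inter> \<Gamma> 1 y"
  shows "(\<Sum>u\<in>D. \<Sum>v\<in>D. \<sigma> (\<partial> u v))
    = a\<^sub>1 * \<sigma> 0 + (a\<^sub>1 * a\<^sub>1 - a\<^sub>1 - far_pairs x y) * \<sigma> 1 + far_pairs x y * \<sigma> 2"
proof -
  define N where "N j = (\<Sum>u\<in>D. \<Sum>v\<in>D. of_bool (\<partial> u v = j) :: real)" for j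
  have cardD: "card D = a\<^sub>1" using card_common_neighbours[OF xy] by (simp add: D_def)
  have "\<partial> u v \<in> {0, 1, 2}" if "u \<in> D" "v \<in> D" for u v
  proof -
    have "\<partial> u v \<le> 2" using dist_triangle[of u v x] that dist_sym[of u x] by (simp add: D_def)
    moreover have "n \<in> {0, 1, 2}" if "n \<le> 2" for n :: nat using that by auto
    ultimately show ?thesis by blast
  qed
  then have split: "g (\<partial> u v) = of_bool (\<partial> u v = 0) * g 0 + of_bool (\<partial> u v = 1) * g 1
      + of_bool (\<partial> u v = 2) * g 2" if "u \<in> D" "v \<in> D" for g :: "nat \<Rightarrow> real" and u v
    using that by fastforce
  have total: "(\<Sum>u\<in>D. \<Sum>v\<in>D. g (\<partial> u v)) = N 0 * g 0 + N 1 * g 1 + N 2 * g 2" for g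
  proof -
    have "(\<Sum>u\<in>D. \<Sum>v\<in>D. g (\<partial> u v)) = (\<Sum>u\<in>D. \<Sum>v\<in>D. of_bool (\<partial> u v = 0) * g 0
        + of_bool (\<partial> u v = 1) * g 1 + of_bool (\<partial> u v = 2) * g 2)"
      using split by (intro sum.cong refl)
    then show ?thesis by (simp add: N_def sum.distrib sum_distrib_right)
  qed
  have "N 0 = (\<Sum>u\<in>D. 1)" unfolding N_def
    by (intro sum.cong refl) (simp add: of_bool_def sum.delta)
  then have N0: "N 0 = a\<^sub>1" using cardD by simp
  have "N 2 = (\<Sum>(u, v)\<in>D \<times> D. of_bool (\<partial> u v = 2))"
    unfolding N_def by (rule sum.cartesian_product)
  also have "\<dots> = real (card {z \<in> D \<times> D. \<partial> (fst z) (snd z) = 2})"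
    by (simp add: of_bool_def sum.If_cases case_prod_beta Int_def)
  also have "{z \<in> D \<times> D. \<partial> (fst z) (snd z) = 2}
      = {(u, v). u \<in> \<Gamma> 1 x \<inter> \<Gamma> 1 y \<and> v \<in> \<Gamma> 1 x \<inter> \<Gamma> 1 y \<and> \<partial> u v = 2}"
    unfolding D_def by auto
  finally have N2: "N 2 = far_pairs x y" by (simp add: far_pairs_def)
  have "a\<^sub>1 * a\<^sub>1 = N 0 + N 1 + N 2" using total[of "\<lambda>_. 1"] cardD by simp
  then have "N 1 = a\<^sub>1 * a\<^sub>1 - a\<^sub>1 - far_pairs x y" using N0 N2 by simp
  then show ?thesis using total[of \<sigma>] N0 N2 by simp
qed

lemma gram_identity:
  assumes c: "cosine_sequence t \<sigma>" and xy: "\<partial> x y = 1"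
  defines "D \<equiv> \<Gamma> 1 x \<inter> \<Gamma> 1 y"
  shows "\<kappa> ^ 2 * b\<^sub>1 *
      ((1 + \<sigma> 1) * (\<Sum>u\<in>D. \<Sum>v\<in>D. \<sigma> (\<partial> u v)) - 2 * a\<^sub>1\<^sup>2 * (\<sigma> 1)\<^sup>2)
    = - ((\<kappa> - t) * gram_poly (far_pairs x y) t)"
proof -
  define S where "S = (\<Sum>u\<in>D. \<Sum>v\<in>D. \<sigma> (\<partial> u v))"
  define k a b n s1 s2 where "k = \<kappa>" and "a = a\<^sub>1" and "b = b\<^sub>1"
    and "n = far_pairs x y" and "s1 = \<sigma> 1" and "s2 = \<sigma> 2"
  note defs = S_def k_def a_def b_def n_def s1_def s2_def
  have S: "S = a + (a * a - a - n) * s1 + n * s2"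
    using sum_common_neighbours[OF xy, of \<sigma>] cosine_0[OF c] by (simp add: D_def defs)
  have t: "t = k * s1" and s2: "b * s2 = t * s1 - 1 - a * s1" and k: "k = 1 + a + b"
    using cosine_1[OF c] cosine_2[OF c] valency_split by (simp_all add: defs)
  have "b * S = b * a + b * (a * a - a - n) * s1 + n * (b * s2)"
    by (simp add: S algebra_simps)
  then have bS: "b * S = b * a + b * (a * a - a - n) * s1 + n * (k * s1 * s1 - 1 - a * s1)"
    using s2 t by simp
  have "k ^ 2 * b * ((1 + s1) * S - 2 * a\<^sup>2 * s1\<^sup>2)
      = k ^ 2 * ((1 + s1) * (b * S) - 2 * b * a\<^sup>2 * s1\<^sup>2)"
    by (simp add: algebra_simps)
  also have "\<dots> = - ((k - t) * (n * (t + k) * (t + 1) - a * b * ((a + 1) * t + k)))"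
    unfolding bS t unfolding k by (simp add: algebra_simps power2_eq_square)
  finally show ?thesis by (simp add: gram_poly_def defs)
qed

text \<open>
  The test vector is the component of the sum of the common neighbours orthogonal to \<open>x\<close> and
  \<open>y\<close> in the eigenspace, cleared of denominators.
\<close>

lemma gram_form:
  assumes c: "cosine_sequence t \<sigma>" and xy: "\<partial> x y = 1"
  defines "D \<equiv> \<Gamma> 1 x \<inter> \<Gamma> 1 y"
  defines "w \<equiv> \<lambda>z. (1 + \<sigma> 1) * of_bool (z \<in> D) - a\<^sub>1 * \<sigma> 1 * (of_bool (z = x) + of_bool (z = y))"
  shows gram_form_apply: "(\<Sum>z\<in>UNIV. w z * h z) = (1 + \<sigma> 1) * (\<Sum>z\<in>D. h z) - a\<^sub>1 * \<sigma> 1 * (h x + h y)"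
    and gram_form_value: "(\<Sum>u\<in>UNIV. \<Sum>v\<in>UNIV. w u * w v * \<sigma> (\<partial> u v))
      = (1 + \<sigma> 1) * ((1 + \<sigma> 1) * (\<Sum>u\<in>D. \<Sum>v\<in>D. \<sigma> (\<partial> u v)) - 2 * a\<^sub>1\<^sup>2 * (\<sigma> 1)\<^sup>2)"
proof -
  have app: "(\<Sum>z\<in>UNIV. w z * h z) = (1 + \<sigma> 1) * (\<Sum>z\<in>D. h z) - a\<^sub>1 * \<sigma> 1 * (h x + h y)" for h
  proof -
    have "(\<Sum>z\<in>UNIV. w z * h z) = (1 + \<sigma> 1) * (\<Sum>z\<in>UNIV. if z \<in> D then h z else 0)
        - a\<^sub>1 * \<sigma> 1 * ((\<Sum>z\<in>UNIV. if z = x then h z else 0) + (\<Sum>z\<in>UNIV. if z = y then h z else 0))"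
      unfolding w_def sum_distrib_left sum.distrib[symmetric] sum_subtractf[symmetric]
      by (intro sum.cong) (auto simp: algebra_simps)
    then show ?thesis by (simp add: sum.If_cases)
  qed
  then show "(\<Sum>z\<in>UNIV. w z * h z) = (1 + \<sigma> 1) * (\<Sum>z\<in>D. h z) - a\<^sub>1 * \<sigma> 1 * (h x + h y)" .
  have cardD: "card D = a\<^sub>1" using card_common_neighbours[OF xy] by (simp add: D_def)
  define G where "G u = (1 + \<sigma> 1) * (\<Sum>v\<in>D. \<sigma> (\<partial> u v)) - a\<^sub>1 * \<sigma> 1 * (\<sigma> (\<partial> u x) + \<sigma> (\<partial> u y))" for u
  have one: "(\<Sum>v\<in>D. \<sigma> (\<partial> u v)) = a\<^sub>1 * \<sigma> 1" if "u = x \<or> u = y" for u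
    using that cardD by (subst sum.cong[of D D _ "\<lambda>_. \<sigma> 1"]) (auto simp: D_def)
  have one': "(\<Sum>v\<in>D. \<sigma> (\<partial> v u)) = a\<^sub>1 * \<sigma> 1" if "u = x \<or> u = y" for u
    using one[OF that] by (simp add: dist_sym)
  have Gxy: "G x = 0" "G y = 0"
    unfolding G_def using one xy dist_sym[of y x] cosine_0[OF c] by (simp_all add: algebra_simps)
  have "(\<Sum>v\<in>UNIV. w u * w v * \<sigma> (\<partial> u v)) = w u * G u" for u
    using app[of "\<lambda>v. \<sigma> (\<partial> u v)"] unfolding G_def by (simp add: mult.assoc flip: sum_distrib_left)
  then have "(\<Sum>u\<in>UNIV. \<Sum>v\<in>UNIV. w u * w v * \<sigma> (\<partial> u v)) = (\<Sum>u\<in>UNIV. w u * G u)"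
    by simp
  also have "\<dots> = (1 + \<sigma> 1) * (\<Sum>u\<in>D. G u)" unfolding app using Gxy by simp
  also have "(\<Sum>u\<in>D. G u) = (1 + \<sigma> 1) * (\<Sum>u\<in>D. \<Sum>v\<in>D. \<sigma> (\<partial> u v)) - 2 * a\<^sub>1\<^sup>2 * (\<sigma> 1)\<^sup>2"
    unfolding G_def sum_subtractf sum_distrib_left[symmetric] sum.distrib
    using one'[of x] one'[of y] by (simp add: power2_eq_square algebra_simps)
  finally show "(\<Sum>u\<in>UNIV. \<Sum>v\<in>UNIV. w u * w v * \<sigma> (\<partial> u v))
      = (1 + \<sigma> 1) * ((1 + \<sigma> 1) * (\<Sum>u\<in>D. \<Sum>v\<in>D. \<sigma> (\<partial> u v)) - 2 * a\<^sub>1\<^sup>2 * (\<sigma> 1)\<^sup>2)" .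
qed

lemma gram_poly_nonpos:
  assumes t: "t \<in> graph_eigenvalues R" "\<bar>t\<bar> < \<kappa>" and xy: "\<partial> x y = 1"
  shows "gram_poly (far_pairs x y) t \<le> 0"
proof -
  define D where "D = \<Gamma> 1 x \<inter> \<Gamma> 1 y"
  obtain \<sigma> where \<sigma>: "cosine_sequence t \<sigma>" using cosine_sequence_exists t by blast
  define X where "X = (1 + \<sigma> 1) * (\<Sum>u\<in>D. \<Sum>v\<in>D. \<sigma> (\<partial> u v)) - 2 * a\<^sub>1\<^sup>2 * (\<sigma> 1)\<^sup>2"
  have "\<kappa> * (1 + \<sigma> 1) > 0" using cosine_1[OF \<sigma>] t by (simp add: algebra_simps)
  then have s1: "1 + \<sigma> 1 > 0" using valency_pos by (simp add: zero_less_mult_iff)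
  have "0 \<le> (1 + \<sigma> 1) * X"
    unfolding X_def D_def gram_form_value[OF \<sigma> xy, symmetric] by (rule cosine_form_nonneg[OF \<sigma>])
  then have "0 \<le> X" using s1 by (simp add: zero_le_mult_iff)
  then have "0 \<le> \<kappa> ^ 2 * b\<^sub>1 * X" by simp
  then have "0 \<le> - ((\<kappa> - t) * gram_poly (far_pairs x y) t)"
    unfolding X_def D_def gram_identity[OF \<sigma> xy] .
  then show ?thesis using t by (auto simp: mult_le_0_iff)
qed

lemma gram_poly_eq_0_iff:
  assumes \<sigma>: "cosine_sequence t \<sigma>" and t: "\<bar>t\<bar> < \<kappa>" and xy: "\<partial> x y = 1"
  defines "D \<equiv> \<Gamma> 1 x \<inter> \<Gamma> 1 y"
  shows gram_poly_eq_0_imp_dependent: "gram_poly (far_pairs x y) t = 0 \<Longrightarrow>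
      (1 + \<sigma> 1) * (\<Sum>u\<in>D. \<sigma> (\<partial> u z)) = a\<^sub>1 * \<sigma> 1 * (\<sigma> (\<partial> x z) + \<sigma> (\<partial> y z))"
    and dependent_imp_gram_poly_eq_0:
      "(\<And>z. (\<Sum>u\<in>D. \<sigma> (\<partial> u z)) = \<alpha> * \<sigma> (\<partial> x z) + \<beta> * \<sigma> (\<partial> y z)) \<Longrightarrow>
      gram_poly (far_pairs x y) t = 0"
proof -
  define X where "X = (1 + \<sigma> 1) * (\<Sum>u\<in>D. \<Sum>v\<in>D. \<sigma> (\<partial> u v)) - 2 * a\<^sub>1\<^sup>2 * (\<sigma> 1)\<^sup>2"
  have id: "\<kappa> ^ 2 * b\<^sub>1 * X = - ((\<kappa> - t) * gram_poly (far_pairs x y) t)"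
    unfolding X_def D_def by (rule gram_identity[OF \<sigma> xy])
  {
    assume "gram_poly (far_pairs x y) t = 0"
    then have "X = 0" using id valency_pos b1_pos by auto
    then show "(1 + \<sigma> 1) * (\<Sum>u\<in>D. \<sigma> (\<partial> u z)) = a\<^sub>1 * \<sigma> 1 * (\<sigma> (\<partial> x z) + \<sigma> (\<partial> y z))"
      using cosine_form_radical[OF \<sigma>, OF gram_form_value[OF \<sigma> xy, folded D_def, folded X_def,
            unfolded \<open>X = 0\<close> mult_zero_right], of z]
        gram_form_apply[OF \<sigma> xy, of "\<lambda>u. \<sigma> (\<partial> u z)"]
      unfolding D_def by linarith
  next
    assume dep: "\<And>z. (\<Sum>u\<in>D. \<sigma> (\<partial> u z)) = \<alpha> * \<sigma> (\<partial> x z) + \<beta> * \<sigma> (\<partial> y z)"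
    have cardD: "card D = a\<^sub>1" using card_common_neighbours[OF xy] by (simp add: D_def)
    have s1: "\<sigma> 1 \<noteq> 1" using cosine_1[OF \<sigma>] t by auto
    have one: "(\<Sum>u\<in>D. \<sigma> (\<partial> u z)) = a\<^sub>1 * \<sigma> 1" if "z = x \<or> z = y" for z
      using that cardD by (subst sum.cong[of D D _ "\<lambda>_. \<sigma> 1"]) (auto simp: D_def dist_sym)
    have ex: "a\<^sub>1 * \<sigma> 1 = \<alpha> + \<beta> * \<sigma> 1" and ey: "a\<^sub>1 * \<sigma> 1 = \<alpha> * \<sigma> 1 + \<beta>"
      using dep[of x] dep[of y] one[of x] one[of y] xy dist_sym[of y x] cosine_0[OF \<sigma>] by auto
    have "(\<alpha> - \<beta>) * (1 - \<sigma> 1) = 0" using ex ey by (simp add: algebra_simps)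
    then have ab: "\<beta> = \<alpha>" using s1 by simp
    have "(\<Sum>u\<in>D. \<Sum>v\<in>D. \<sigma> (\<partial> u v)) = (\<Sum>v\<in>D. \<Sum>u\<in>D. \<sigma> (\<partial> u v))" by (rule sum.swap)
    also have "\<dots> = (\<Sum>v\<in>D. 2 * \<alpha> * \<sigma> 1)"
      unfolding dep ab by (intro sum.cong) (auto simp: D_def)
    also have "\<dots> = a\<^sub>1 * (2 * \<alpha> * \<sigma> 1)" using cardD by simp
    finally have "X = 2 * a\<^sub>1 * \<sigma> 1 * (\<alpha> * (1 + \<sigma> 1)) - 2 * a\<^sub>1\<^sup>2 * (\<sigma> 1)\<^sup>2"
      by (simp add: X_def algebra_simps)
    also have "\<alpha> * (1 + \<sigma> 1) = a\<^sub>1 * \<sigma> 1" using ex ab by (simp add: algebra_simps)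
    finally have "X = 0" by (simp add: power2_eq_square)
    then show "gram_poly (far_pairs x y) t = 0" using id t by auto
  }
qed

end

section \<open>Tightness as a condition on one edge\<close>

context drg
begin

lemma abs_eigenvalue_less:
  assumes "\<not> bipartite R" "t \<in> graph_eigenvalues R" "t \<noteq> \<kappa>"
  shows "\<bar>t\<bar> < \<kappa>"
proof -
  have "t \<noteq> - \<kappa>" using assms bipartite_if_minus_valency by blast
  then show ?thesis using abs_eigenvalue_le[OF assms(2)] assms(3) by linarith
qed

lemma tight_iff:
  "tight R \<longleftrightarrow> \<not> bipartite R \<and>
     (theta R 1 + \<kappa> / (a\<^sub>1 + 1)) * (theta R d + \<kappa> / (a\<^sub>1 + 1)) = - (\<kappa> * a\<^sub>1 * b\<^sub>1) / (a\<^sub>1 + 1)\<^sup>2"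
  by (simp add: tight_def Let_def)

lemma not_bipartite_if_a1_nonzero: "a_num R 1 \<noteq> 0 \<Longrightarrow> \<not> bipartite R"
  unfolding bipartite_def using diam by (meson le_trans one_le_numeral)

text \<open>With \<open>a\<^sub>1 = 0\<close> the tightness equation forces \<open>- \<kappa>\<close> to be an eigenvalue.\<close>

lemma tight_imp_a1_nonzero:
  assumes "tight R"
  shows "a_num R 1 \<noteq> 0"
proof
  assume "a_num R 1 = 0"
  then have "theta R 1 = - \<kappa> \<or> theta R d = - \<kappa>"
    using assms unfolding tight_iff by (auto simp: eq_neg_iff_add_eq_0)
  then have "- \<kappa> \<in> graph_eigenvalues R"
    using theta_1_eigenvalue theta_d_eigenvalue by metis
  then show False using assms bipartite_if_minus_valency unfolding tight_iff by blast
qed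

text \<open>In the coordinate \<open>t + \<kappa> / (a\<^sub>1 + 1)\<close> the tightness condition prescribes a product.\<close>

lemma gram_poly_shifted:
  defines "e \<equiv> \<kappa> / (a\<^sub>1 + 1)"
  shows "gram_poly n t = n * (t + e)\<^sup>2
      + (n * (\<kappa> + 1 - 2 * e) - a\<^sub>1 * b\<^sub>1 * (a\<^sub>1 + 1)) * (t + e)
      - n * (\<kappa> * a\<^sub>1 * b\<^sub>1 / (a\<^sub>1 + 1)\<^sup>2)"
proof -
  have pos: "a\<^sub>1 + 1 > 0" by simp
  have e: "\<kappa> = e * (a\<^sub>1 + 1)" using pos by (simp add: e_def)
  have b: "b\<^sub>1 = e * (a\<^sub>1 + 1) - 1 - a\<^sub>1" using valency_split e by simp
  have "\<kappa> * a\<^sub>1 * b\<^sub>1 / (a\<^sub>1 + 1)\<^sup>2 = e * a\<^sub>1 * (e - 1)"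
  proof -
    have "\<kappa> * a\<^sub>1 * b\<^sub>1 = e * a\<^sub>1 * (e - 1) * (a\<^sub>1 + 1)\<^sup>2"
      unfolding b by (subst e) (simp add: algebra_simps power2_eq_square)
    then show ?thesis using pos by (simp only:) (rule nonzero_mult_div_cancel_right, simp)
  qed
  then show ?thesis unfolding gram_poly_def b
    by (simp only:) (subst (1 2 3) e, simp add: algebra_simps power2_eq_square)
qed

text \<open>
  If the two shifted eigenvalues have the prescribed negative product, the quadratic is at
  each of them the eigenvalue times the same number; being nonpositive at a positive and at a
  negative one, it vanishes at both.
\<close>

lemma tight_imp_gram_poly_eq_0:
  assumes tight: "tight R" and xy: "\<partial> x y = 1"
  shows "gram_poly (far_pairs x y) (theta R 1) = 0" "gram_poly (far_pairs x y) (theta R d) = 0"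
proof -
  define e n B where "e = \<kappa> / (a\<^sub>1 + 1)" and "n = far_pairs x y"
    and "B = n * (\<kappa> + 1 - 2 * e) - a\<^sub>1 * b\<^sub>1 * (a\<^sub>1 + 1)"
  define u v where "u = theta R 1 + e" and "v = theta R d + e"
  have uv: "u * v = - (\<kappa> * a\<^sub>1 * b\<^sub>1) / (a\<^sub>1 + 1)\<^sup>2" and nb: "\<not> bipartite R"
    using tight unfolding tight_iff u_def v_def e_def by auto
  have a: "a\<^sub>1 > 0" using tight_imp_a1_nonzero[OF tight] by simp
  have P1: "gram_poly n (theta R 1) = u * (n * (u + v) + B)"
    unfolding gram_poly_shifted e_def[symmetric] B_def[symmetric] u_def[symmetric]
    using uv by (simp add: algebra_simps power2_eq_square)
  have Pd: "gram_poly n (theta R d) = v * (n * (u + v) + B)"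
    unfolding gram_poly_shifted e_def[symmetric] B_def[symmetric] v_def[symmetric]
    using uv by (simp add: algebra_simps power2_eq_square)
  have abs: "\<bar>theta R 1\<bar> < \<kappa>" "\<bar>theta R d\<bar> < \<kappa>"
    using abs_eigenvalue_less[OF nb] theta_1_eigenvalue theta_d_eigenvalue theta_1_less
      theta_d_less by auto
  then have le: "u * (n * (u + v) + B) \<le> 0" "v * (n * (u + v) + B) \<le> 0"
    using gram_poly_nonpos[OF theta_1_eigenvalue _ xy] gram_poly_nonpos[OF theta_d_eigenvalue _ xy]
    unfolding n_def[symmetric] P1 Pd by auto
  have "u * v < 0" unfolding uv using a b1_pos valency_pos
    by (intro divide_neg_pos) auto
  moreover have "v < u" using theta_d_less by (simp add: u_def v_def)
  ultimately have "0 < u" "v < 0" by (auto simp: mult_less_0_iff)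
  then have "n * (u + v) + B = 0" using le by (auto simp: mult_le_0_iff)
  then show "gram_poly (far_pairs x y) (theta R 1) = 0" "gram_poly (far_pairs x y) (theta R d) = 0"
    using P1 Pd by (auto simp: n_def)
qed

text \<open>
  Conversely, two zeros of the convex quadratic enclose every point at which it is nonpositive.
\<close>

lemma tight_if_two_zeros:
  assumes a1: "a_num R 1 \<noteq> 0" and xy: "\<partial> x y = 1"
    and s: "s \<in> graph_eigenvalues R" "s \<noteq> \<kappa>" "gram_poly (far_pairs x y) s = 0"
    and t: "t \<in> graph_eigenvalues R" "t \<noteq> \<kappa>" "gram_poly (far_pairs x y) t = 0"
    and "s < t"
  shows "tight R"
proof -
  define e n B where "e = \<kappa> / (a\<^sub>1 + 1)" and "n = far_pairs x y"
    and "B = n * (\<kappa> + 1 - 2 * e) - a\<^sub>1 * b\<^sub>1 * (a\<^sub>1 + 1)"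
  define C where "C = \<kappa> * a\<^sub>1 * b\<^sub>1 / (a\<^sub>1 + 1)\<^sup>2"
  have P: "gram_poly n r = n * (r + e)\<^sup>2 + B * (r + e) - n * C" for r
    unfolding gram_poly_shifted e_def B_def C_def by simp
  have nb: "\<not> bipartite R" using not_bipartite_if_a1_nonzero a1 by blast
  have zs: "n * (s + e)\<^sup>2 + B * (s + e) = n * C" and zt: "n * (t + e)\<^sup>2 + B * (t + e) = n * C"
    using s t P unfolding n_def by auto
  have "(t - s) * (n * (s + e + (t + e)) + B) = 0"
    using zs zt by (simp add: algebra_simps power2_eq_square)
  then have B: "B = - n * (s + e + (t + e))" using \<open>s < t\<close> by auto
  have n: "n \<noteq> 0"
  proof
    assume "n = 0"
    then have "a\<^sub>1 * b\<^sub>1 * (a\<^sub>1 + 1) = 0" using B by (simp add: B_def)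
    then show False using a1 b1_pos by simp
  qed
  moreover have "n \<ge> 0" unfolding n_def far_pairs_def by (rule of_nat_0_le_iff)
  ultimately have npos: "n > 0" by simp
  have "n * C = n * (- ((s + e) * (t + e)))" using zs unfolding B
    by (simp add: algebra_simps power2_eq_square)
  then have C: "C = - ((s + e) * (t + e))" using n by (simp only: mult_cancel_left) simp
  have "gram_poly n r = n * ((r - s) * (r - t))" for r
    unfolding P B C by (simp add: algebra_simps power2_eq_square)
  then have between: "(r - s) * (r - t) \<le> 0" if "r \<in> graph_eigenvalues R" "r \<noteq> \<kappa>" for r
    using gram_poly_nonpos[OF that(1) abs_eigenvalue_less[OF nb that] xy] npos
    by (simp add: n_def[symmetric] mult_le_0_iff)
  have 1: "theta R 1 = t"
    using between[OF theta_1_eigenvalue] theta_1_less theta_1_ge[OF t(1,2)] \<open>s < t\<close>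
    by (auto simp: mult_le_0_iff)
  have d: "theta R d = s"
    using between[OF theta_d_eigenvalue] theta_1_less theta_d_less theta_d_le[OF s(1)] \<open>s < t\<close>
    by (auto simp: mult_le_0_iff)
  show ?thesis unfolding tight_iff 1 d e_def[symmetric]
    using nb C by (simp add: C_def mult.commute)
qed

text \<open>
  Two consecutive zeros would propagate down to \<open>\<sigma> 0\<close> through the three-term recurrence.
\<close>

lemma cosine_no_consecutive_zeros:
  assumes c: "cosine_sequence t \<sigma>"
  shows "i < d \<Longrightarrow> \<sigma> i = 0 \<Longrightarrow> \<sigma> (Suc i) \<noteq> 0"
proof (induction i)
  case 0
  then show ?case using cosine_0[OF c] by simp
next
  case (Suc i)
  have "\<sigma> (Suc (Suc i)) \<noteq> 0"
  proof
    assume z: "\<sigma> (Suc (Suc i)) = 0"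
    obtain u v where uv: "\<partial> u v = Suc i" using gdist_attained[OF conn, of "Suc i"] Suc by auto
    obtain w where w: "\<partial> u w = 1" "\<partial> w v = i" using step_towards[OF uv] by blast
    have "0 = (\<Sum>z\<in>\<Gamma> 1 u. \<sigma> (\<partial> z v))"
      using c Suc.prems uv unfolding cosine_sequence_def eigenfunction_def layer_sum_def by simp
    also have "\<dots> = (\<Sum>z\<in>\<Gamma> 1 u. of_bool (\<partial> z v = i) * \<sigma> i)"
    proof (intro sum.cong refl)
      fix z assume "z \<in> \<Gamma> 1 u"
      then have "\<partial> z v = i \<or> \<partial> z v = Suc i \<or> \<partial> z v = Suc (Suc i)"
        using dist_adjacent(1,2)[of u z v] uv by auto
      then show "\<sigma> (\<partial> z v) = of_bool (\<partial> z v = i) * \<sigma> i"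
        using z Suc.prems by auto
    qed
    also have "\<dots> = (\<Sum>z\<in>\<Gamma> 1 u. of_bool (\<partial> z v = i)) * \<sigma> i" by (rule sum_distrib_right[symmetric])
    also have "(\<Sum>z\<in>\<Gamma> 1 u. of_bool (\<partial> z v = i)) \<ge> (of_bool (\<partial> w v = i) :: real)"
      using w by (intro member_le_sum) auto
    ultimately have "\<sigma> i = 0" using w by auto
    then show False using Suc by auto
  qed
  then show ?case by simp
qed

section \<open>Functions that are constant on the cells of an edge\<close>

definition cell_constant :: "'a \<Rightarrow> 'a \<Rightarrow> ('a \<Rightarrow> real) \<Rightarrow> bool" where
  "cell_constant x y f \<longleftrightarrow> (\<forall>z z'. \<partial> x z = \<partial> x z' \<longrightarrow> \<partial> y z = \<partial> y z' \<longrightarrow> f z = f z')"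

lemma cell_constantI:
  "(\<And>z z'. \<partial> x z = \<partial> x z' \<Longrightarrow> \<partial> y z = \<partial> y z' \<Longrightarrow> f z = f z') \<Longrightarrow> cell_constant x y f"
  unfolding cell_constant_def by blast

lemma cell_constantD:
  "cell_constant x y f \<Longrightarrow> \<partial> x z = \<partial> x z' \<Longrightarrow> \<partial> y z = \<partial> y z' \<Longrightarrow> f z = f z'"
  unfolding cell_constant_def by blast

definition cell_indicator :: "'a \<Rightarrow> 'a \<Rightarrow> nat \<Rightarrow> nat \<Rightarrow> 'a \<Rightarrow> real" where
  "cell_indicator x y i j z = of_bool (\<partial> x z = i \<and> \<partial> y z = j)"

lemma cell_constant_expand:
  assumes "cell_constant x y f"
  shows "\<exists>c. \<forall>z. f z = (\<Sum>i\<le>d. \<Sum>j\<le>d. c i j * cell_indicator x y i j z)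
    \<and> c (\<partial> x z) (\<partial> y z) = f z"
proof -
  define c where "c i j = f (SOME z. \<partial> x z = i \<and> \<partial> y z = j)" for i j
  have c: "c (\<partial> x z) (\<partial> y z) = f z" for z
  proof -
    let ?z = "SOME w. \<partial> x w = \<partial> x z \<and> \<partial> y w = \<partial> y z"
    have "\<partial> x ?z = \<partial> x z \<and> \<partial> y ?z = \<partial> y z"
      by (rule someI[of _ z]) simp
    then show ?thesis using assms unfolding c_def cell_constant_def by blast
  qed
  have "f z = (\<Sum>i\<le>d. \<Sum>j\<le>d. c i j * cell_indicator x y i j z)" for z
  proof -
    have "(\<Sum>i\<le>d. \<Sum>j\<le>d. c i j * cell_indicator x y i j z)
        = (\<Sum>i\<le>d. if i = \<partial> x z then (\<Sum>j\<le>d. if j = \<partial> y z then c i j else 0) else 0)"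
      unfolding cell_indicator_def by (intro sum.cong refl) (auto intro!: sum.cong sum.neutral)
    then show ?thesis using c by (simp add: sum.delta')
  qed
  then show ?thesis using c by blast
qed

lemma one_homogeneous_iff_cell_constant:
  assumes xy: "\<partial> x y = 1"
  shows "one_homogeneous_wrt R x y \<longleftrightarrow>
    (\<forall>r\<le>d. \<forall>s\<le>d. cell_constant x y (layer_sum 1 (cell_indicator x y r s)))"
proof -
  have ls: "layer_sum 1 (cell_indicator x y r s) z = real (card (\<Gamma> 1 z \<inter> edge_cell R x y r s))"
    for r s z
    using layer_sum_indicator[of 1 "edge_cell R x y r s" z]
    by (simp add: cell_indicator_def[abs_def] edge_cell_def)
  have p1: "p 1 i j \<noteq> 0 \<longleftrightarrow> edge_cell R x y i j \<noteq> {}" if "i \<le> d" "j \<le> d" for i j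
  proof -
    have "card (edge_cell R x y i j) = p 1 i j"
      using card_layer_Int[OF that, of x y] xy by (simp add: edge_cell_def)
    then show ?thesis by (metis card_eq_0_iff finite)
  qed
  have cell: "z \<in> edge_cell R x y i j \<longleftrightarrow> \<partial> x z = i \<and> \<partial> y z = j" for z i j
    by (simp add: edge_cell_def)
  show ?thesis
  proof
    assume hom: "one_homogeneous_wrt R x y"
    show "\<forall>r\<le>d. \<forall>s\<le>d. cell_constant x y (layer_sum 1 (cell_indicator x y r s))"
    proof (intro allI impI)
      fix r s assume rs: "r \<le> d" "s \<le> d"
      show "cell_constant x y (layer_sum 1 (cell_indicator x y r s))"
      proof (cases "edge_cell R x y r s = {}")
        case True
        then show ?thesis unfolding cell_constant_def ls by simp
      next
        case False
        show ?thesis unfolding cell_constant_def ls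
        proof (intro allI impI)
          fix z z' assume eq: "\<partial> x z = \<partial> x z'" "\<partial> y z = \<partial> y z'"
          have "p 1 (\<partial> x z) (\<partial> y z) \<noteq> 0" "p 1 r s \<noteq> 0"
            using p1 False rs cell by auto
          then obtain m where "\<forall>w\<in>edge_cell R x y (\<partial> x z) (\<partial> y z).
              card (\<Gamma> 1 w \<inter> edge_cell R x y r s) = m"
            using hom rs unfolding one_homogeneous_wrt_def by (meson dist_le)
          then show "real (card (\<Gamma> 1 z \<inter> edge_cell R x y r s))
              = real (card (\<Gamma> 1 z' \<inter> edge_cell R x y r s))"
            using eq cell by simp
        qed
      qed
    qed
  next
    assume hom: "\<forall>r\<le>d. \<forall>s\<le>d. cell_constant x y (layer_sum 1 (cell_indicator x y r s))"
    show "one_homogeneous_wrt R x y" unfolding one_homogeneous_wrt_def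
    proof (intro allI impI)
      fix i j r s assume rs: "r \<le> d" "s \<le> d"
      have eq: "card (\<Gamma> 1 z \<inter> edge_cell R x y r s) = card (\<Gamma> 1 z' \<inter> edge_cell R x y r s)"
        if "z \<in> edge_cell R x y i j" "z' \<in> edge_cell R x y i j" for z z'
        using hom rs that unfolding cell_constant_def ls cell by auto
      then show "\<exists>m. \<forall>z\<in>edge_cell R x y i j. card (\<Gamma> 1 z \<inter> edge_cell R x y r s) = m"
        by (cases "edge_cell R x y i j = {}") blast+
    qed
  qed
qed

text \<open>
  These functions form the largest space of cell-constant functions that is invariant under
  all distance matrices.
\<close>

definition stable_function :: "'a \<Rightarrow> 'a \<Rightarrow> ('a \<Rightarrow> real) \<Rightarrow> bool" where
  "stable_function x y f \<longleftrightarrow> (\<forall>j. cell_constant x y (layer_sum j f))"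

lemma stable_functionI:
  "(\<And>j z z'. \<partial> x z = \<partial> x z' \<Longrightarrow> \<partial> y z = \<partial> y z' \<Longrightarrow> layer_sum j f z = layer_sum j f z')
    \<Longrightarrow> stable_function x y f"
  unfolding stable_function_def by (blast intro: cell_constantI)

lemma stable_functionD:
  "stable_function x y f \<Longrightarrow> \<partial> x z = \<partial> x z' \<Longrightarrow> \<partial> y z = \<partial> y z'
    \<Longrightarrow> layer_sum j f z = layer_sum j f z'"
  unfolding stable_function_def by (blast intro: cell_constantD)

lemma stable_imp_cell_constant: "stable_function x y f \<Longrightarrow> cell_constant x y f"
  using stable_functionD[where j = 0] by (intro cell_constantI) simp

lemma stable_function_diff:
  assumes "stable_function x y f" "stable_function x y g"
  shows "stable_function x y (\<lambda>z. f z - g z)"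
  by (intro stable_functionI, unfold layer_sum_linear)
    (intro arg_cong2[where f = "(-)"] stable_functionD[OF assms(1)] stable_functionD[OF assms(2)])

lemma stable_function_scale:
  assumes "stable_function x y f"
  shows "stable_function x y (\<lambda>z. c * f z)"
  by (intro stable_functionI, unfold layer_sum_linear)
    (intro arg_cong2[where f = "(*)"] refl stable_functionD[OF assms])

lemma stable_function_sum:
  assumes "\<And>j. j \<in> J \<Longrightarrow> stable_function x y (h j)"
  shows "stable_function x y (\<lambda>z. \<Sum>j\<in>J. h j z)"
  by (intro stable_functionI, unfold layer_sum_linear)
    (intro sum.cong refl stable_functionD[OF assms])

lemma stable_function_zero: "stable_function x y (\<lambda>z. 0)"
  by (intro stable_functionI) (simp add: layer_sum_def)

lemma stable_function_layer_sum:
  assumes "stable_function x y f"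
  shows "stable_function x y (layer_sum i f)"
proof (rule stable_functionI)
  fix j z z' assume eq: "\<partial> x z = \<partial> x z'" "\<partial> y z = \<partial> y z'"
  show "layer_sum j (layer_sum i f) z = layer_sum j (layer_sum i f) z'"
  proof (cases "i \<le> d \<and> j \<le> d")
    case True
    then show ?thesis
      by (simp only: layer_sum_layer_sum stable_functionD[OF assms eq])
  next
    case False
    then show ?thesis
      by (auto simp: not_le layer_sum_def[of j] layer_sum_beyond_diameter layer_beyond_diameter)
  qed
qed

lemma stable_function_layer:
  assumes "u = x \<or> u = y"
  shows "stable_function x y (\<lambda>z. of_bool (\<partial> u z = i))"
proof -
  have "layer_sum j (\<lambda>z. of_bool (z = u)) z = of_bool (\<partial> u z = j)" for j z
    using layer_sum_indicator[of j "{u}" z] dist_sym[of u z] by auto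
  then have stable: "stable_function x y (\<lambda>z. of_bool (z = u))"
    and eq: "layer_sum i (\<lambda>z. of_bool (z = u)) = (\<lambda>z. of_bool (\<partial> u z = i))"
    using assms unfolding stable_function_def cell_constant_def by auto
  show ?thesis unfolding eq[symmetric] by (rule stable_function_layer_sum[OF stable])
qed

lemma edge_cell_cases:
  assumes "\<partial> x y = 1"
  obtains "\<partial> x z = \<partial> y z" "0 < \<partial> x z" | "\<partial> x z = Suc (\<partial> y z)" | "\<partial> y z = Suc (\<partial> x z)"
proof -
  have "\<partial> x z = 0 \<Longrightarrow> \<partial> y z = 1" using assms dist_sym[of x y] by auto
  then show ?thesis using dist_adjacent(1,2)[OF assms, of z] that by linarith
qed

text \<open>
  The cells can be peeled off one distance at a time: the indicators of the layers of \<open>x\<close> and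
  \<open>y\<close> yield the cells off the diagonal, and the \<open>m\<close>-th distance matrix applied to the common
  neighbours yields the diagonal cell at distance \<open>Suc m\<close>, provided that it does not vanish
  there.
\<close>

lemma stable_cell_indicators:
  assumes xy: "\<partial> x y = 1"
    and stable: "stable_function x y (cell_indicator x y 1 1)"
    and nz: "\<And>z m. \<partial> x z = Suc m \<Longrightarrow> \<partial> y z = Suc m \<Longrightarrow> layer_sum m (cell_indicator x y 1 1) z \<noteq> 0"
  shows "stable_function x y (cell_indicator x y i j)"
proof -
  let ?I = "cell_indicator x y"
  let ?S = "stable_function x y"
  have tri: "stable_function x y (?I m m) \<and> stable_function x y (?I (Suc m) m) \<and> stable_function x y (?I m (Suc m))" for m
  proof (induction m rule: less_induct)
    case (less m)
    have diag: "?S (?I m m)"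
    proof (cases m)
      case 0
      then have "?I m m = (\<lambda>z. 0)"
        using xy by (auto simp: cell_indicator_def fun_eq_iff)
      then show ?thesis using stable_function_zero by simp
    next
      case (Suc n)
      let ?w = "layer_sum n (?I 1 1)"
      have Sw: "?S ?w" by (rule stable_function_layer_sum[OF stable])
      from cell_constant_expand[OF stable_imp_cell_constant[OF Sw]]
      obtain c where "\<forall>z. ?w z = (\<Sum>i\<le>d. \<Sum>j\<le>d. c i j * ?I i j z) \<and> c (\<partial> x z) (\<partial> y z) = ?w z" ..
      then have w: "\<And>z. ?w z = (\<Sum>i\<le>d. \<Sum>j\<le>d. c i j * ?I i j z)"
        and c: "\<And>z. c (\<partial> x z) (\<partial> y z) = ?w z" by simp_all
      show ?thesis
      proof (cases "\<exists>z. \<partial> x z = m \<and> \<partial> y z = m")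
        case False
        then have "?I m m = (\<lambda>z. 0)" by (auto simp: cell_indicator_def fun_eq_iff)
        then show ?thesis using stable_function_zero by simp
      next
        case True
        then obtain z0 where z0: "\<partial> x z0 = m" "\<partial> y z0 = m" by blast
        then have m: "m \<le> d" by (metis dist_le)
        have cm: "c m m \<noteq> 0" using c[of z0] nz[of z0 n] z0 Suc by simp
        have other: "?S (\<lambda>z. c i j * ?I i j z)" if ij: "(i, j) \<noteq> (m, m)" for i j
        proof (cases "\<exists>z. \<partial> x z = i \<and> \<partial> y z = j \<and> ?w z \<noteq> 0")
          case False
          then have "(\<lambda>z. c i j * ?I i j z) = (\<lambda>z. 0)"
            using c by (auto simp: cell_indicator_def fun_eq_iff)
          then show ?thesis using stable_function_zero by simp
        next
          case True
          then obtain z where z: "\<partial> x z = i" "\<partial> y z = j" "?w z \<noteq> 0" by blast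
          then have "\<exists>u\<in>\<Gamma> n z. ?I 1 1 u \<noteq> 0" unfolding layer_sum_def by (meson sum.neutral)
          then obtain u where u: "\<partial> z u = n" "\<partial> x u = 1" "\<partial> y u = 1"
            unfolding cell_indicator_def by auto
          then have "\<partial> x z \<le> m" "\<partial> y z \<le> m"
            using dist_triangle[of x z u] dist_triangle[of y z u] dist_sym[of u z] Suc by auto
          then have "?S (?I i j)"
            using edge_cell_cases[OF xy, of z] less z ij
            by (metis Suc_le_eq le_neq_implies_less)
          then show ?thesis by (rule stable_function_scale)
        qed
        define J where "J = {..d} \<times> {..d} - {(m, m)}"
        have "c m m * ?I m m z = ?w z - (\<Sum>(i, j)\<in>J. c i j * ?I i j z)" for z
        proof -
          have "?w z = (\<Sum>(i, j)\<in>{..d} \<times> {..d}. c i j * ?I i j z)"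
            unfolding w by (rule sum.cartesian_product)
          then show ?thesis unfolding J_def using m by (simp add: sum_diff1)
        qed
        moreover have "?S (\<lambda>z. ?w z - (\<Sum>(i, j)\<in>J. c i j * ?I i j z))"
        proof (intro stable_function_diff Sw)
          have "?S (\<lambda>z. \<Sum>q\<in>J. c (fst q) (snd q) * ?I (fst q) (snd q) z)"
          proof (rule stable_function_sum)
            fix q assume "q \<in> J"
            then have "(fst q, snd q) \<noteq> (m, m)" by (auto simp: J_def)
            then show "?S (\<lambda>z. c (fst q) (snd q) * ?I (fst q) (snd q) z)" by (rule other)
          qed
          then show "?S (\<lambda>z. \<Sum>(i, j)\<in>J. c i j * ?I i j z)" by (simp add: case_prod_beta)
        qed
        ultimately have "?S (\<lambda>z. c m m * ?I m m z)" by simp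
        from stable_function_scale[OF this, of "1 / c m m"] show ?thesis using cm by simp
      qed
    qed
    have prev: "?S (\<lambda>z. of_bool (0 < m) * ?I m (m - 1) z)" "?S (\<lambda>z. of_bool (0 < m) * ?I (m - 1) m z)"
      using less[of "m - 1"] by (cases m; simp add: stable_function_zero)+
    have dec: "?I (Suc m) m = (\<lambda>z. of_bool (\<partial> y z = m) - ?I m m z - of_bool (0 < m) * ?I (m - 1) m z)"
        "?I m (Suc m) = (\<lambda>z. of_bool (\<partial> x z = m) - ?I m m z - of_bool (0 < m) * ?I m (m - 1) z)"
    proof -
      have "?I (Suc m) m z = of_bool (\<partial> y z = m) - ?I m m z - of_bool (0 < m) * ?I (m - 1) m z
        \<and> ?I m (Suc m) z = of_bool (\<partial> x z = m) - ?I m m z - of_bool (0 < m) * ?I m (m - 1) z" for z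
        by (rule edge_cell_cases[OF xy, of z]) (auto simp: cell_indicator_def)
      then show "?I (Suc m) m = (\<lambda>z. of_bool (\<partial> y z = m) - ?I m m z - of_bool (0 < m) * ?I (m - 1) m z)"
        "?I m (Suc m) = (\<lambda>z. of_bool (\<partial> x z = m) - ?I m m z - of_bool (0 < m) * ?I m (m - 1) z)"
        by auto
    qed
    have "?S (?I (Suc m) m)" "?S (?I m (Suc m))"
      unfolding dec by (intro stable_function_diff stable_function_layer diag prev; simp)+
    then show ?case using diag by blast
  qed
  show ?thesis
  proof (cases "\<exists>z. \<partial> x z = i \<and> \<partial> y z = j")
    case True
    then obtain z where "\<partial> x z = i" "\<partial> y z = j" by blast
    then show ?thesis using edge_cell_cases[OF xy, of z] tri by metis
  next
    case False
    then have "?I i j = (\<lambda>z. 0)" by (auto simp: cell_indicator_def fun_eq_iff)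
    then show ?thesis using stable_function_zero by simp
  qed
qed

end

section \<open>Edges with two vanishing Gram determinants\<close>

context drg
begin

text \<open>The number of common neighbours of \<open>x\<close> and \<open>y\<close> at distance \<open>j\<close> from a vertex.\<close>

definition common_at :: "'a \<Rightarrow> 'a \<Rightarrow> nat \<Rightarrow> 'a \<Rightarrow> real" where
  "common_at x y j = layer_sum j (cell_indicator x y 1 1)"

lemma common_at_range:
  assumes "common_at x y j z \<noteq> 0"
  shows "j \<le> d" "j \<le> \<partial> x z + 1" "j \<le> \<partial> y z + 1" "\<partial> x z \<le> j + 1" "\<partial> y z \<le> j + 1"
proof -
  have "\<exists>u\<in>\<Gamma> j z. cell_indicator x y 1 1 u \<noteq> 0"
    using assms unfolding common_at_def layer_sum_def by (meson sum.neutral)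
  then obtain u where u: "\<partial> z u = j" "\<partial> x u = 1" "\<partial> y u = 1"
    unfolding cell_indicator_def by auto
  show "j \<le> d" using dist_le[of z u] u by simp
  show "j \<le> \<partial> x z + 1" "j \<le> \<partial> y z + 1" "\<partial> x z \<le> j + 1" "\<partial> y z \<le> j + 1"
    using dist_adjacent(1,2)[OF u(2), of z] dist_adjacent(1,2)[OF u(3), of z] u(1)
      dist_sym[of u z] by simp_all
qed

lemma sum_common_at:
  assumes J: "finite J" "\<And>j. common_at x y j z \<noteq> 0 \<Longrightarrow> j \<in> J"
  shows "(\<Sum>u\<in>\<Gamma> 1 x \<inter> \<Gamma> 1 y. g (\<partial> u z)) = (\<Sum>j\<in>J. common_at x y j z * g j)"
proof -
  have "(\<Sum>u\<in>\<Gamma> 1 x \<inter> \<Gamma> 1 y. g (\<partial> u z)) = (\<Sum>u\<in>UNIV. cell_indicator x y 1 1 u * g (\<partial> z u))"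
    by (intro sum.mono_neutral_cong_left) (auto simp: cell_indicator_def dist_sym)
  also have "\<dots> = (\<Sum>j\<le>d. \<Sum>u\<in>\<Gamma> j z. cell_indicator x y 1 1 u * g (\<partial> z u))"
    by (rule sum_by_distance)
  also have "\<dots> = (\<Sum>j\<le>d. common_at x y j z * g j)"
    unfolding common_at_def layer_sum_def sum_distrib_right by (intro sum.cong) auto
  also have "\<dots> = (\<Sum>j\<in>J. common_at x y j z * g j)"
    using J common_at_range(1)[of x y _ z] by (intro sum.mono_neutral_cong) auto
  finally show ?thesis .
qed

end

locale tight_edge = drg +
  fixes x y :: 'a and s t :: real and \<sigma> \<rho> :: "nat \<Rightarrow> real"
  assumes edge: "\<partial> x y = 1" and a1_nonzero: "a_num R 1 \<noteq> 0" and distinct: "s \<noteq> t"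
    and \<sigma>: "cosine_sequence s \<sigma>" "\<bar>s\<bar> < \<kappa>" "gram_poly (far_pairs x y) s = 0"
    and \<rho>: "cosine_sequence t \<rho>" "\<bar>t\<bar> < \<kappa>" "gram_poly (far_pairs x y) t = 0"
begin

abbreviation N where "N \<equiv> common_at x y"

text \<open>
  For each of the two eigenvalues, the projection of the sum of the common neighbours is
  \<open>weight\<close> times the sum of the projections of \<open>x\<close> and \<open>y\<close>.
\<close>

definition weight :: "(nat \<Rightarrow> real) \<Rightarrow> real" where
  "weight \<tau> = a\<^sub>1 * \<tau> 1 / (1 + \<tau> 1)"

lemma a1_pos: "a\<^sub>1 > 0"
  using a1_nonzero by simp

lemma cosine_bounds: "\<bar>\<sigma> 1\<bar> < 1" "\<bar>\<rho> 1\<bar> < 1"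
proof -
  have "\<bar>\<kappa> * \<sigma> 1\<bar> < \<kappa> * 1" "\<bar>\<kappa> * \<rho> 1\<bar> < \<kappa> * 1"
    unfolding cosine_1[OF \<sigma>(1)] cosine_1[OF \<rho>(1)] using \<sigma>(2) \<rho>(2) by simp_all
  then show "\<bar>\<sigma> 1\<bar> < 1" "\<bar>\<rho> 1\<bar> < 1"
    using valency_pos unfolding abs_mult by simp_all
qed

lemma weights_distinct: "weight \<sigma> \<noteq> weight \<rho>"
proof
  assume eq: "weight \<sigma> = weight \<rho>"
  have nz: "1 + \<sigma> 1 \<noteq> 0" "1 + \<rho> 1 \<noteq> 0" using cosine_bounds by auto
  have "a\<^sub>1 * \<sigma> 1 * (1 + \<rho> 1) = a\<^sub>1 * \<rho> 1 * (1 + \<sigma> 1)"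
    using eq unfolding weight_def frac_eq_eq[OF nz] .
  then have "a\<^sub>1 * (\<sigma> 1 - \<rho> 1) = 0" by (simp add: algebra_simps)
  then have "\<sigma> 1 = \<rho> 1" using a1_pos by simp
  then show False using distinct cosine_1[OF \<sigma>(1)] cosine_1[OF \<rho>(1)] by simp
qed

lemma weight_dependence:
  assumes "\<tau> = \<sigma> \<or> \<tau> = \<rho>"
  shows "(\<Sum>u\<in>\<Gamma> 1 x \<inter> \<Gamma> 1 y. \<tau> (\<partial> u z)) = weight \<tau> * (\<tau> (\<partial> x z) + \<tau> (\<partial> y z))"
proof -
  have "1 + \<sigma> 1 \<noteq> 0" "1 + \<rho> 1 \<noteq> 0" using cosine_bounds by auto
  then show ?thesis
    using gram_poly_eq_0_imp_dependent[OF \<sigma>(1,2) edge \<sigma>(3), of z]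
      gram_poly_eq_0_imp_dependent[OF \<rho>(1,2) edge \<rho>(3), of z] assms
    by (auto simp: weight_def field_simps)
qed

lemma weight_not_half:
  assumes "\<tau> = \<sigma> \<or> \<tau> = \<rho>"
  shows "2 * weight \<tau> \<noteq> a\<^sub>1"
proof
  assume eq: "2 * weight \<tau> = a\<^sub>1"
  have "\<bar>\<tau> 1\<bar> < 1" using assms cosine_bounds by auto
  then have "1 + \<tau> 1 \<noteq> 0" "\<tau> 1 \<noteq> 1" by auto
  then show False using eq a1_pos by (simp add: weight_def field_simps)
qed

lemma off_diagonal_sum:
  assumes "\<partial> x z = Suc i \<and> \<partial> y z = i \<or> \<partial> x z = i \<and> \<partial> y z = Suc i"
  shows "N i z + N (Suc i) z = a\<^sub>1"
    and "\<tau> = \<sigma> \<or> \<tau> = \<rho> \<Longrightarrow>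
      N i z * \<tau> i + N (Suc i) z * \<tau> (Suc i) = weight \<tau> * (\<tau> i + \<tau> (Suc i))"
proof -
  have *: "(\<Sum>u\<in>\<Gamma> 1 x \<inter> \<Gamma> 1 y. g (\<partial> u z)) = N i z * g i + N (Suc i) z * g (Suc i)" for g
  proof -
    have "(\<Sum>u\<in>\<Gamma> 1 x \<inter> \<Gamma> 1 y. g (\<partial> u z)) = (\<Sum>j\<in>{i, Suc i}. N j z * g j)"
      using common_at_range[of x y _ z] assms by (intro sum_common_at) fastforce+
    then show ?thesis by simp
  qed
  show "N i z + N (Suc i) z = a\<^sub>1"
    using *[of "\<lambda>_. 1"] card_common_neighbours[OF edge] by simp
  show "N i z * \<tau> i + N (Suc i) z * \<tau> (Suc i) = weight \<tau> * (\<tau> i + \<tau> (Suc i))"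
    if "\<tau> = \<sigma> \<or> \<tau> = \<rho>"
    using *[of \<tau>] weight_dependence[OF that, of z] assms by (auto simp: add.commute)
qed

lemma diagonal_sum:
  assumes "\<partial> x z = Suc i" "\<partial> y z = Suc i"
  shows "N i z + N (Suc i) z + N (Suc (Suc i)) z = a\<^sub>1"
    and "\<tau> = \<sigma> \<or> \<tau> = \<rho> \<Longrightarrow>
      N i z * \<tau> i + N (Suc i) z * \<tau> (Suc i) + N (Suc (Suc i)) z * \<tau> (Suc (Suc i))
        = 2 * weight \<tau> * \<tau> (Suc i)"
proof -
  have *: "(\<Sum>u\<in>\<Gamma> 1 x \<inter> \<Gamma> 1 y. g (\<partial> u z))
      = N i z * g i + N (Suc i) z * g (Suc i) + N (Suc (Suc i)) z * g (Suc (Suc i))" for g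
  proof -
    have "(\<Sum>u\<in>\<Gamma> 1 x \<inter> \<Gamma> 1 y. g (\<partial> u z)) = (\<Sum>j\<in>{i, Suc i, Suc (Suc i)}. N j z * g j)"
      using common_at_range[of x y _ z] assms by (intro sum_common_at) fastforce+
    then show ?thesis by simp
  qed
  show "N i z + N (Suc i) z + N (Suc (Suc i)) z = a\<^sub>1"
    using *[of "\<lambda>_. 1"] card_common_neighbours[OF edge] by simp
  show "N i z * \<tau> i + N (Suc i) z * \<tau> (Suc i) + N (Suc (Suc i)) z * \<tau> (Suc (Suc i))
        = 2 * weight \<tau> * \<tau> (Suc i)" if "\<tau> = \<sigma> \<or> \<tau> = \<rho>"
    using *[of \<tau>] weight_dependence[OF that, of z] assms by simp
qed

text \<open>
  If two consecutive cosines agreed, the equation for the cell between them would read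
  \<open>a\<^sub>1 * \<tau> i = 2 * weight \<tau> * \<tau> i\<close>, so both would vanish.
\<close>

lemma consecutive_cosines_distinct:
  assumes \<tau>: "\<tau> = \<sigma> \<or> \<tau> = \<rho>" and i: "i < d"
  shows "\<tau> i \<noteq> \<tau> (Suc i)"
proof
  assume eq: "\<tau> i = \<tau> (Suc i)"
  obtain z where z: "\<partial> x z = Suc i" "\<partial> y z = i"
    using edge_cell_offdiagonal_nonempty(1)[OF edge i] by blast
  then have "(N i z + N (Suc i) z) * \<tau> i = 2 * weight \<tau> * \<tau> i"
    using off_diagonal_sum(2)[OF _ \<tau>, of z i] eq by (simp add: algebra_simps)
  then have "(a\<^sub>1 - 2 * weight \<tau>) * \<tau> i = 0"
    using off_diagonal_sum(1)[of z i] z by (simp add: algebra_simps)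
  then have "\<tau> i = 0" using weight_not_half[OF \<tau>] by simp
  then show False
    using cosine_no_consecutive_zeros[OF \<sigma>(1) i] cosine_no_consecutive_zeros[OF \<rho>(1) i] \<tau> eq
    by auto
qed

text \<open>
  The number of common neighbours of \<open>x\<close> and \<open>y\<close> at distance \<open>i\<close> from a vertex in either
  cell between distances \<open>i\<close> and \<open>Suc i\<close>.
\<close>

definition off_count :: "nat \<Rightarrow> real" where
  "off_count i = (weight \<sigma> * (\<sigma> i + \<sigma> (Suc i)) - a\<^sub>1 * \<sigma> (Suc i)) / (\<sigma> i - \<sigma> (Suc i))"

lemma off_diagonal_count:
  assumes z: "\<partial> x z = Suc i \<and> \<partial> y z = i \<or> \<partial> x z = i \<and> \<partial> y z = Suc i"
  shows "N i z = off_count i" "N (Suc i) z = a\<^sub>1 - off_count i"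
proof -
  have i: "i < d" using z dist_le[of x z] dist_le[of y z] by linarith
  have sum: "N (Suc i) z = a\<^sub>1 - N i z" using off_diagonal_sum(1)[OF z] by simp
  have "N i z * (\<sigma> i - \<sigma> (Suc i)) = weight \<sigma> * (\<sigma> i + \<sigma> (Suc i)) - a\<^sub>1 * \<sigma> (Suc i)"
    using off_diagonal_sum(2)[OF z, of \<sigma>] unfolding sum by (simp add: algebra_simps)
  then show "N i z = off_count i"
    using consecutive_cosines_distinct[of \<sigma>, OF _ i] by (simp add: off_count_def field_simps)
  then show "N (Suc i) z = a\<^sub>1 - off_count i" using sum by simp
qed

lemma off_count_equations:
  assumes \<tau>: "\<tau> = \<sigma> \<or> \<tau> = \<rho>" and i: "i < d"
  shows "(2 * weight \<tau> - a\<^sub>1) * \<tau> (Suc i) = (off_count i - weight \<tau>) * (\<tau> i - \<tau> (Suc i))"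
    and "(2 * weight \<tau> - a\<^sub>1) * \<tau> i = (off_count i + weight \<tau> - a\<^sub>1) * (\<tau> i - \<tau> (Suc i))"
proof -
  obtain z where z: "\<partial> x z = Suc i" "\<partial> y z = i"
    using edge_cell_offdiagonal_nonempty(1)[OF edge i] by blast
  have "off_count i * \<tau> i + (a\<^sub>1 - off_count i) * \<tau> (Suc i) = weight \<tau> * (\<tau> i + \<tau> (Suc i))"
    using off_diagonal_sum(2)[OF _ \<tau>, of z i] off_diagonal_count[of z i] z by simp
  then show "(2 * weight \<tau> - a\<^sub>1) * \<tau> (Suc i) = (off_count i - weight \<tau>) * (\<tau> i - \<tau> (Suc i))"
    "(2 * weight \<tau> - a\<^sub>1) * \<tau> i = (off_count i + weight \<tau> - a\<^sub>1) * (\<tau> i - \<tau> (Suc i))"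
    by (simp_all add: algebra_simps)
qed

text \<open>
  The equation for a diagonal cell, in the differences of consecutive cosines, with the
  right-hand side expressed by the cells below or above it. Divided by one of the differences,
  the right-hand side depends on the eigenvalue through \<open>weight \<tau>\<close> only. As the two weights
  differ, neither of the two counts can vanish, and the equations of the two eigenvalues are
  independent.
\<close>

lemma diagonal_equation_lower:
  assumes \<tau>: "\<tau> = \<sigma> \<or> \<tau> = \<rho>" and z: "\<partial> x z = Suc i" "\<partial> y z = Suc i"
  shows "N i z * (\<tau> i - \<tau> (Suc i)) - N (Suc (Suc i)) z * (\<tau> (Suc i) - \<tau> (Suc (Suc i)))
    = (off_count i - weight \<tau>) * (\<tau> i - \<tau> (Suc i))"
proof -
  have i: "i < d" using z dist_le[of x z] by simp
  have mid: "N (Suc i) z = a\<^sub>1 - N i z - N (Suc (Suc i)) z" using diagonal_sum(1)[OF z] by simp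
  show ?thesis
    using diagonal_sum(2)[OF z \<tau>, unfolded mid] off_count_equations(1)[OF \<tau> i] by (simp add: algebra_simps)
qed

lemma diagonal_equation_upper:
  assumes \<tau>: "\<tau> = \<sigma> \<or> \<tau> = \<rho>" and z: "\<partial> x z = Suc i" "\<partial> y z = Suc i" and i: "Suc i < d"
  shows "N i z * (\<tau> i - \<tau> (Suc i)) - N (Suc (Suc i)) z * (\<tau> (Suc i) - \<tau> (Suc (Suc i)))
    = (off_count (Suc i) + weight \<tau> - a\<^sub>1) * (\<tau> (Suc i) - \<tau> (Suc (Suc i)))"
proof -
  have mid: "N (Suc i) z = a\<^sub>1 - N i z - N (Suc (Suc i)) z" using diagonal_sum(1)[OF z] by simp
  show ?thesis
    using diagonal_sum(2)[OF z \<tau>, unfolded mid] off_count_equations(2)[OF \<tau> i] by (simp add: algebra_simps)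
qed

text \<open>
  At distance \<open>d\<close> the count at distance \<open>d + 1\<close> does vanish, so the cell has no vertex.
\<close>

lemma diagonal_cell_d_empty:
  assumes z: "\<partial> x z = d" "\<partial> y z = d"
  shows False
proof -
  obtain i where i: "d = Suc i" using diam by (cases d) auto
  have top: "N (Suc (Suc i)) z = 0" using common_at_range(1)[of x y "Suc (Suc i)" z] i by auto
  have "N i z = off_count i - weight \<tau>" if \<tau>: "\<tau> = \<sigma> \<or> \<tau> = \<rho>" for \<tau>
    using diagonal_equation_lower[OF \<tau>, of z i] consecutive_cosines_distinct[OF \<tau>, of i] z i top
    by auto
  from this[of \<sigma>] this[of \<rho>] show False using weights_distinct by auto
qed

lemma diagonal_count_nonzero:
  assumes z: "\<partial> x z = Suc i" "\<partial> y z = Suc i"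
  shows "N i z \<noteq> 0"
proof
  assume 0: "N i z = 0"
  have i: "Suc i < d"
    using diagonal_cell_d_empty[of z] dist_le[of x z] z by (cases "Suc i = d") auto
  have "- N (Suc (Suc i)) z = off_count (Suc i) + weight \<tau> - a\<^sub>1" if \<tau>: "\<tau> = \<sigma> \<or> \<tau> = \<rho>" for \<tau>
  proof -
    have "(- N (Suc (Suc i)) z) * (\<tau> (Suc i) - \<tau> (Suc (Suc i)))
        = (off_count (Suc i) + weight \<tau> - a\<^sub>1) * (\<tau> (Suc i) - \<tau> (Suc (Suc i)))"
      using diagonal_equation_upper[OF \<tau> z i] 0 by simp
    then show ?thesis using consecutive_cosines_distinct[OF \<tau> i] by (simp only: mult_cancel_right) simp
  qed
  from this[of \<sigma>] this[of \<rho>] show False using weights_distinct by auto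
qed

lemma diagonal_count_constant:
  assumes z: "\<partial> x z = Suc i" "\<partial> y z = Suc i" and z': "\<partial> x z' = Suc i" "\<partial> y z' = Suc i"
  shows "N j z = N j z'"
proof -
  have i: "Suc i < d"
    using diagonal_cell_d_empty[of z] dist_le[of x z] z by (cases "Suc i = d") auto
  define u v u' v' where "u = \<sigma> i - \<sigma> (Suc i)" and "v = \<sigma> (Suc i) - \<sigma> (Suc (Suc i))"
    and "u' = \<rho> i - \<rho> (Suc i)" and "v' = \<rho> (Suc i) - \<rho> (Suc (Suc i))"
  note uv = u_def v_def u'_def v'_def
  have nz: "u \<noteq> 0" "u' \<noteq> 0" "v \<noteq> 0"
    using consecutive_cosines_distinct[of \<sigma> i] consecutive_cosines_distinct[of \<rho> i]
      consecutive_cosines_distinct[of \<sigma> "Suc i"] i by (auto simp: uv)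
  have eq: "N i w * u - N (Suc (Suc i)) w * v = (off_count i - weight \<sigma>) * u"
    "N i w * u' - N (Suc (Suc i)) w * v' = (off_count i - weight \<rho>) * u'"
    if "\<partial> x w = Suc i" "\<partial> y w = Suc i" for w
    using diagonal_equation_lower[of \<sigma> w i] diagonal_equation_lower[of \<rho> w i] that
    by (simp_all add: uv)
  have "N (Suc (Suc i)) z * (u * v' - u' * v)
      = (N i z * u - N (Suc (Suc i)) z * v) * u' - (N i z * u' - N (Suc (Suc i)) z * v') * u"
    by (simp add: algebra_simps)
  also have "\<dots> = (weight \<rho> - weight \<sigma>) * u * u'"
    unfolding eq[OF z] by (simp add: algebra_simps)
  finally have det: "u * v' - u' * v \<noteq> 0" using nz weights_distinct by auto
  define e f where "e = N i z - N i z'" and "f = N (Suc (Suc i)) z - N (Suc (Suc i)) z'"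
  have e: "e * u = f * v" "e * u' = f * v'"
    using eq[OF z] eq[OF z'] by (simp_all add: e_def f_def algebra_simps)
  have "e * (u * v' - u' * v) = (e * u) * v' - (e * u') * v" by (simp add: algebra_simps)
  then have "e = 0" using det e by simp
  then have "f = 0" using e nz by simp
  have low: "N i z = N i z'" and high: "N (Suc (Suc i)) z = N (Suc (Suc i)) z'"
    using \<open>e = 0\<close> \<open>f = 0\<close> by (simp_all add: e_def f_def)
  then have mid: "N (Suc i) z = N (Suc i) z'"
    using diagonal_sum(1)[OF z] diagonal_sum(1)[OF z'] by simp
  show ?thesis
  proof (cases "j \<in> {i, Suc i, Suc (Suc i)}")
    case False
    have "N j w = 0" if w: "\<partial> x w = Suc i" for w
    proof (rule ccontr)
      assume "N j w \<noteq> 0"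
      then have "j \<le> Suc (Suc i)" "i \<le> j" using common_at_range(2,4)[of x y j w] w by simp_all
      then show False using False by auto
    qed
    then show ?thesis using z z' by simp
  qed (use low mid high in auto)
qed

lemma off_diagonal_count_constant:
  assumes z: "\<partial> x z = Suc i \<and> \<partial> y z = i \<or> \<partial> x z = i \<and> \<partial> y z = Suc i"
    and z': "\<partial> x z' = \<partial> x z" "\<partial> y z' = \<partial> y z"
  shows "N j z = N j z'"
proof (cases "j \<in> {i, Suc i}")
  case True
  then show ?thesis using off_diagonal_count[OF z] off_diagonal_count[OF z[folded z']] by auto
next
  case False
  have "N j w = 0" if w: "\<partial> x w = \<partial> x z" "\<partial> y w = \<partial> y z" for w
  proof (rule ccontr)
    assume "N j w \<noteq> 0"
    then have "j \<le> Suc i" "i \<le> j" using common_at_range[of x y j w] w z by auto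
    then show False using False by auto
  qed
  then show ?thesis using z' by simp
qed

lemma stable_common_neighbours: "stable_function x y (cell_indicator x y 1 1)"
proof (rule stable_functionI)
  fix j z z' assume eq: "\<partial> x z = \<partial> x z'" "\<partial> y z = \<partial> y z'"
  have "N j z = N j z'"
  proof (rule edge_cell_cases[OF edge, of z])
    assume "\<partial> x z = \<partial> y z" "0 < \<partial> x z"
    then obtain i where "\<partial> x z = Suc i" "\<partial> y z = Suc i" by (metis not0_implies_Suc less_irrefl)
    then show ?thesis using diagonal_count_constant[of z i z'] eq by simp
  next
    assume "\<partial> x z = Suc (\<partial> y z)"
    from disjI1[OF conjI[OF this refl]] show ?thesis
      by (rule off_diagonal_count_constant) (use eq in simp_all)
  next
    assume "\<partial> y z = Suc (\<partial> x z)"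
    from disjI2[OF conjI[OF refl this]] show ?thesis
      by (rule off_diagonal_count_constant) (use eq in simp_all)
  qed
  then show "layer_sum j (cell_indicator x y 1 1) z = layer_sum j (cell_indicator x y 1 1) z'"
    by (simp add: common_at_def)
qed

lemma one_homogeneous_edge: "one_homogeneous_wrt R x y"
proof -
  have "layer_sum m (cell_indicator x y 1 1) z \<noteq> 0" if "\<partial> x z = Suc m" "\<partial> y z = Suc m" for z m
    using diagonal_count_nonzero[OF that] by (simp add: common_at_def)
  from stable_cell_indicators[OF edge stable_common_neighbours this]
  show ?thesis
    unfolding one_homogeneous_iff_cell_constant[OF edge] by (simp add: stable_function_def)
qed

lemma a_d_eq_0: "a_num R d = 0"
proof -
  have "\<not> (\<exists>y'. \<partial> v y' = 1 \<and> \<partial> u y' = d)" if uv: "\<partial> v u = d" for u v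
  proof
    assume "\<exists>y'. \<partial> v y' = 1 \<and> \<partial> u y' = d"
    then obtain w where w: "\<partial> v w = 1" "\<partial> u w = d" by blast
    \<comment> \<open>The cell at distance \<open>d\<close> from both ends is empty for the given edge, hence for every edge.\<close>
    have "0 < p 1 d d"
      using p_pos_iff[of d d v w] w uv dist_sym[of u w] by auto
    then show False using p_pos_iff[of d d x y] edge diagonal_cell_d_empty by auto
  qed
  moreover obtain u v where "\<partial> v u = d" using diameter_attained by blast
  ultimately show ?thesis using p_pos_iff[of 1 d v u] diam by (auto simp: a_num_def)
qed

end

section \<open>One homogeneous edge\<close>

context drg
begin

lemma cell_constant_layer_sum:
  assumes xy: "\<partial> x y = 1" and hom: "one_homogeneous_wrt R x y" and f: "cell_constant x y f"
  shows "cell_constant x y (layer_sum 1 f)"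
proof -
  from cell_constant_expand[OF f]
  obtain c where "\<forall>z. f z = (\<Sum>i\<le>d. \<Sum>j\<le>d. c i j * cell_indicator x y i j z)
      \<and> c (\<partial> x z) (\<partial> y z) = f z" ..
  then have "f = (\<lambda>z. \<Sum>i\<le>d. \<Sum>j\<le>d. c i j * cell_indicator x y i j z)" by blast
  then have eq: "layer_sum 1 f z
      = (\<Sum>i\<le>d. \<Sum>j\<le>d. c i j * layer_sum 1 (cell_indicator x y i j) z)" for z
    by (simp only: layer_sum_linear)
  have const: "cell_constant x y (layer_sum 1 (cell_indicator x y i j))" if "i \<le> d" "j \<le> d" for i j
    using hom that unfolding one_homogeneous_iff_cell_constant[OF xy] by blast
  show ?thesis unfolding eq
    by (intro cell_constantI sum.cong refl arg_cong2[where f = "(*)"])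
      (rule cell_constantD[OF const], auto)
qed

text \<open>
  With \<open>a\<^sub>d = 0\<close> there is no cell at distance \<open>d\<close> from both ends of the edge, so at most
  \<open>3 * d - 1\<close> cells are left.
\<close>

lemma cell_constant_span:
  assumes xy: "\<partial> x y = 1" and ad: "a_num R d = 0"
  shows "\<exists>B :: (real ^ 'a) set. finite B \<and> card B \<le> 3 * d - 1 \<and>
    (\<forall>f. cell_constant x y f \<longrightarrow> (\<chi> z. f z) \<in> span B)"
proof -
  let ?C = "(\<lambda>i. (Suc i, i)) ` {..<d} \<union> (\<lambda>i. (i, Suc i)) ` {..<d} \<union> (\<lambda>i. (i, i)) ` {1..<d}"
  let ?v = "\<lambda>q. (\<chi> z. cell_indicator x y (fst q) (snd q) z) :: real ^ 'a"
  have "card (?v ` ?C) \<le> card ?C" by (intro card_image_le) simp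
  also have "\<dots> \<le> card ((\<lambda>i. (Suc i, i)) ` {..<d}) + card ((\<lambda>i. (i, Suc i)) ` {..<d})
      + card ((\<lambda>i. (i, i)) ` {1..<d})"
    by (intro order.trans[OF card_Un_le] add_right_mono card_Un_le)
  also have "\<dots> = 3 * d - 1" using diam by (simp add: card_image inj_on_def)
  finally have card: "card (?v ` ?C) \<le> 3 * d - 1" .
  have span: "(\<chi> z. f z) \<in> span (?v ` ?C)" if f: "cell_constant x y f" for f
  proof -
    from cell_constant_expand[OF f]
    obtain c where c: "\<forall>z. f z = (\<Sum>i\<le>d. \<Sum>j\<le>d. c i j * cell_indicator x y i j z)
      \<and> c (\<partial> x z) (\<partial> y z) = f z" ..
    have mem: "(\<partial> x z, \<partial> y z) \<in> ?C" for z
    proof (rule edge_cell_cases[OF xy, of z])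
      assume eq: "\<partial> x z = \<partial> y z" "0 < \<partial> x z"
      have "\<partial> x z \<noteq> d"
      proof
        assume xz: "\<partial> x z = d"
        then have "0 < p (\<partial> x z) 1 d"
          using p_pos_iff[of 1 d x z] diam xy eq dist_sym[of y z] by auto
        then show False using ad xz by (simp add: a_num_def)
      qed
      then have "\<partial> x z \<in> {1..<d}"
        using eq(2) dist_le[of x z] unfolding atLeastLessThan_iff by linarith
      then show ?thesis using eq by auto
    next
      assume eq: "\<partial> x z = Suc (\<partial> y z)"
      then have "\<partial> y z < d" using dist_le[of x z] by linarith
      then show ?thesis unfolding eq by blast
    next
      assume eq: "\<partial> y z = Suc (\<partial> x z)"
      then have "\<partial> x z < d" using dist_le[of y z] by linarith
      then show ?thesis unfolding eq by blast
    qed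
    have "f z = (\<Sum>q\<in>?C. c (fst q) (snd q) * cell_indicator x y (fst q) (snd q) z)" for z
    proof -
      have "(\<Sum>q\<in>?C. c (fst q) (snd q) * cell_indicator x y (fst q) (snd q) z)
          = (\<Sum>q\<in>{(\<partial> x z, \<partial> y z)}. c (fst q) (snd q) * cell_indicator x y (fst q) (snd q) z)"
        using mem[of z] by (intro sum.mono_neutral_right) (auto simp: cell_indicator_def)
      then show ?thesis using c by (simp add: cell_indicator_def)
    qed
    then have "(\<chi> z. f z) = (\<Sum>q\<in>?C. c (fst q) (snd q) *\<^sub>R ?v q)"
      by (simp add: vec_eq_iff)
    also have "\<dots> \<in> span (?v ` ?C)"
      by (intro span_sum span_scale span_base imageI)
    finally show ?thesis .
  qed
  show ?thesis
    by (intro exI[of _ "?v ` ?C"] conjI allI impI card span finite_imageI finite_UnI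
        finite_lessThan finite_atLeastLessThan)
qed

text \<open>
  Up to a scalar, the only linear relation between the indicators of the layers of \<open>x\<close> and
  those of \<open>y\<close> is that both families sum to one: the cells off the diagonal force \<open>g\<close> to be
  constant along each parity class, and a triangle joins the two classes. Then \<open>h d = 0\<close>
  excludes this relation too.
\<close>

lemma layers_independent:
  assumes a1: "a_num R 1 \<noteq> 0" and xy: "\<partial> x y = 1"
    and rel: "\<And>z. g (\<partial> x z) + h (\<partial> y z) = (0::real)" and hd: "h d = 0" and i: "i \<le> d"
  shows "g i = 0" "h i = 0"
proof -
  have up: "g (Suc i) + h i = 0" "g i + h (Suc i) = 0" if "i < d" for i
    using rel edge_cell_offdiagonal_nonempty[OF xy that] by metis+
  have "\<Gamma> 1 x \<inter> \<Gamma> 1 y \<noteq> {}"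
    using card_common_neighbours[OF xy] a1 by (metis card.empty of_nat_eq_iff)
  then obtain z where "\<partial> x z = 1" "\<partial> y z = 1" by auto
  then have tri: "g 1 + h 1 = 0" using rel by metis
  have step: "i < d \<Longrightarrow> g (Suc i) = g i" for i
  proof (induction i)
    case 0
    then show ?case using up(2)[of 0] tri by simp
  next
    case (Suc i)
    then show ?case using up(1)[of "Suc i"] up(2)[of i] by simp
  qed
  have const: "i \<le> d \<Longrightarrow> g i = g 0" for i
    by (induction i) (use step in auto)
  obtain m where m: "d = Suc m" using diam by (cases d) auto
  have "g m = 0" using up(2)[of m] hd m by simp
  then have g: "i \<le> d \<Longrightarrow> g i = 0" for i using const[of i] const[of m] m by simp
  then show "g i = 0" using i .
  show "h i = 0"
  proof (cases "i = d")
    case False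
    then show ?thesis using up(1)[of i] g[of "Suc i"] i by simp
  qed (use hd in simp)
qed

lemma sum_iterate_eigenfunction:
  assumes "eigenfunction t g"
  shows "(\<Sum>z\<in>UNIV. (layer_sum 1 ^^ j) f z * g z) = t ^ j * (\<Sum>z\<in>UNIV. f z * g z)"
proof (induction j)
  case (Suc j)
  have "(\<Sum>z\<in>UNIV. (layer_sum 1 ^^ Suc j) f z * g z)
      = (\<Sum>z\<in>UNIV. (layer_sum 1 ^^ j) f z * layer_sum 1 g z)"
    using layer_sum_symmetric[of 1 "(layer_sum 1 ^^ j) f" g] by simp
  also have "\<dots> = t * (\<Sum>z\<in>UNIV. (layer_sum 1 ^^ j) f z * g z)"
    using assms unfolding eigenfunction_def by (simp add: sum_distrib_left mult_ac)
  finally show ?case using Suc by simp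
qed simp

text \<open>
  The iterates \<open>A\<^sup>j w\<close> for \<open>j \<le> d - 2\<close>, where \<open>A\<close> is the adjacency matrix and \<open>w\<close> the indicator of
  the common neighbours, together with the \<open>2 * d + 1\<close> independent layer indicators outnumber
  the cells. The relation between them has the form \<open>q(A) w = \<dots>\<close> with \<open>q\<close> nonzero of
  degree at most \<open>d - 2\<close>.
\<close>

lemma annihilator_of_common_neighbours:
  assumes a1: "a_num R 1 \<noteq> 0" and ad: "a_num R d = 0"
    and xy: "\<partial> x y = 1" and hom: "one_homogeneous_wrt R x y"
  shows "\<exists>q g h :: nat \<Rightarrow> real. (\<exists>j\<le>d - 2. q j \<noteq> 0) \<and>
    (\<forall>z. (\<Sum>j\<le>d - 2. q j * (layer_sum 1 ^^ j) (cell_indicator x y 1 1) z)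
      + g (\<partial> x z) + h (\<partial> y z) = 0)"
proof -
  let ?w = "cell_indicator x y 1 1"
  have ccw: "cell_constant x y ((layer_sum 1 ^^ j) ?w)" for j
  proof (induction j)
    case 0
    then show ?case by (intro cell_constantI) (simp add: cell_indicator_def)
  next
    case (Suc j)
    then show ?case using cell_constant_layer_sum[OF xy hom] by simp
  qed
  from cell_constant_span[OF xy ad]
  obtain B :: "(real ^ 'a) set" where "finite B \<and> card B \<le> 3 * d - 1 \<and>
    (\<forall>f. cell_constant x y f \<longrightarrow> (\<chi> z. f z) \<in> span B)" ..
  then have B: "finite B" "card B \<le> 3 * d - 1"
    "\<And>f. cell_constant x y f \<Longrightarrow> (\<chi> z. f z) \<in> span B" by simp_all
  define I where "I = Inl ` {..d - 2} \<union> Inr ` (Inl ` {..d} \<union> Inr ` {..<d})"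
  define v :: "nat + nat + nat \<Rightarrow> real ^ 'a" where
    "v = case_sum (\<lambda>j. \<chi> z. (layer_sum 1 ^^ j) ?w z)
      (case_sum (\<lambda>i. \<chi> z. of_bool (\<partial> x z = i)) (\<lambda>i. \<chi> z. of_bool (\<partial> y z = i)))"
  have sumI: "sum f I = (\<Sum>j\<le>d - 2. f (Inl j)) + ((\<Sum>i\<le>d. f (Inr (Inl i))) + (\<Sum>i<d. f (Inr (Inr i))))"
    for f :: "nat + nat + nat \<Rightarrow> 'c::comm_monoid_add"
    unfolding I_def
    by (subst sum.union_disjoint, simp, simp, force, simp add: sum.reindex,
        subst sum.union_disjoint) (auto simp: sum.reindex)
  have finI: "finite I" by (simp add: I_def)
  have "card I = (d - 2 + 1) + ((d + 1) + d)"
    unfolding card_eq_sum sumI by simp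
  then have "card B < card I" using B(2) diam by simp
  moreover have "v i \<in> span B" for i
  proof (cases i)
    case (Inl j)
    show ?thesis unfolding v_def Inl sum.case by (rule B(3)[OF ccw])
  next
    case (Inr k)
    then show ?thesis
      unfolding v_def by (cases k) (auto intro!: B(3) cell_constantI)
  qed
  ultimately obtain c where c: "\<exists>i\<in>I. c i \<noteq> 0" "(\<Sum>i\<in>I. c i *\<^sub>R v i) = 0"
    using family_dependent_if_card_greater[OF finI B(1)] by metis
  define q g h where "q j = c (Inl j)" and "g i = c (Inr (Inl i))"
    and "h i = (if i < d then c (Inr (Inr i)) else 0)" for i j
  have rel: "(\<Sum>j\<le>d - 2. q j * (layer_sum 1 ^^ j) ?w z) + g (\<partial> x z) + h (\<partial> y z) = 0" for z
  proof -
    have "0 = (\<Sum>i\<in>I. c i *\<^sub>R v i) $ z" using c by simp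
    also have "\<dots> = (\<Sum>i\<in>I. c i * v i $ z)" by simp
    also have "\<dots> = (\<Sum>j\<le>d - 2. q j * (layer_sum 1 ^^ j) ?w z)
        + ((\<Sum>i\<le>d. if i = \<partial> x z then g i else 0) + (\<Sum>i<d. if i = \<partial> y z then h i else 0))"
      unfolding sumI v_def q_def g_def h_def
      by (intro arg_cong2[where f = "(+)"] sum.cong) auto
    finally have "0 = (\<Sum>j\<le>d - 2. q j * (layer_sum 1 ^^ j) ?w z)
        + (g (\<partial> x z) + (if \<partial> y z < d then h (\<partial> y z) else 0))" by simp
    moreover have "(if \<partial> y z < d then h (\<partial> y z) else 0) = h (\<partial> y z)" by (simp add: h_def)
    ultimately show ?thesis by simp
  qed
  have "\<exists>j\<le>d - 2. q j \<noteq> 0"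
  proof (rule ccontr)
    assume "\<not> (\<exists>j\<le>d - 2. q j \<noteq> 0)"
    then have q: "\<And>j. j \<le> d - 2 \<Longrightarrow> q j = 0" by blast
    then have "g (\<partial> x z) + h (\<partial> y z) = 0" for z using rel[of z] by simp
    from layers_independent[where g = g and h = h, OF a1 xy this]
    have gh: "g i = 0" "h i = 0" if "i \<le> d" for i using that by (auto simp: h_def)
    have "c (Inr (Inr i)) = 0" if "i < d" for i using gh(2)[of i] that by (simp add: h_def)
    then have "c i = 0" if "i \<in> I" for i
      using that q gh(1) unfolding I_def q_def g_def by auto
    then show False using c(1) by blast
  qed
  then show ?thesis using rel by blast
qed

text \<open>
  At every nontrivial eigenvalue that is not a root of \<open>q\<close> the Gram determinant vanishes, and
  there are \<open>d\<close> nontrivial eigenvalues but at most \<open>d - 2\<close> roots.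
\<close>

lemma tight_if_homogeneous_edge:
  assumes a1: "a_num R 1 \<noteq> 0" and ad: "a_num R d = 0"
    and xy: "\<partial> x y = 1" and hom: "one_homogeneous_wrt R x y"
  shows "tight R"
proof -
  let ?w = "cell_indicator x y 1 1"
  obtain q g h :: "nat \<Rightarrow> real" where "(\<exists>j\<le>d - 2. q j \<noteq> 0) \<and>
      (\<forall>z. (\<Sum>j\<le>d - 2. q j * (layer_sum 1 ^^ j) ?w z) + g (\<partial> x z) + h (\<partial> y z) = 0)"
    using annihilator_of_common_neighbours[OF assms] by (elim exE) (rule that)
  then have q: "\<exists>j\<le>d - 2. q j \<noteq> 0"
    and rel: "\<And>z. (\<Sum>j\<le>d - 2. q j * (layer_sum 1 ^^ j) ?w z) + g (\<partial> x z) + h (\<partial> y z) = 0"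
    by simp_all
  have nb: "\<not> bipartite R" using not_bipartite_if_a1_nonzero a1 by blast
  have zero: "gram_poly (far_pairs x y) t = 0"
    if t: "t \<in> graph_eigenvalues R" "t \<noteq> \<kappa>" "(\<Sum>j\<le>d - 2. q j * t ^ j) \<noteq> 0" for t
  proof -
    define Q where "Q = (\<Sum>j\<le>d - 2. q j * t ^ j)"
    obtain \<tau> where \<tau>: "cosine_sequence t \<tau>" using cosine_sequence_exists t by blast
    have "\<forall>i. \<exists>l. \<forall>f. eigenfunction t f \<longrightarrow> (\<forall>x. layer_sum i f x = l * f x)"
      using layer_sum_eigenfunction by blast
    then obtain l where l: "\<And>i f x. eigenfunction t f \<Longrightarrow> layer_sum i f x = l i * f x" by metis
    define G H where "G = (\<Sum>i\<le>d. g i * l i)" and "H = (\<Sum>i\<le>d. h i * l i)"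
    have ef: "eigenfunction t (\<lambda>z. \<tau> (\<partial> z u))" for u
      using \<tau> by (simp add: cosine_sequence_def)
    have layers: "(\<Sum>z\<in>UNIV. k (\<partial> a z) * \<tau> (\<partial> z u)) = (\<Sum>i\<le>d. k i * l i) * \<tau> (\<partial> a u)" for k a u
    proof -
      have "(\<Sum>z\<in>UNIV. k (\<partial> a z) * \<tau> (\<partial> z u))
          = (\<Sum>i\<le>d. \<Sum>z\<in>\<Gamma> i a. k (\<partial> a z) * \<tau> (\<partial> z u))" by (rule sum_by_distance)
      also have "\<dots> = (\<Sum>i\<le>d. k i * layer_sum i (\<lambda>z. \<tau> (\<partial> z u)) a)"
        unfolding layer_sum_def sum_distrib_left by (intro sum.cong) auto
      finally show ?thesis unfolding l[OF ef] by (simp add: sum_distrib_right mult.assoc)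
    qed
    have dep: "(\<Sum>z\<in>\<Gamma> 1 x \<inter> \<Gamma> 1 y. \<tau> (\<partial> z u)) = (- G / Q) * \<tau> (\<partial> x u) + (- H / Q) * \<tau> (\<partial> y u)" for u
    proof -
      define W where "W = (\<Sum>z\<in>UNIV. ?w z * \<tau> (\<partial> z u))"
      have "0 = (\<Sum>z\<in>UNIV. ((\<Sum>j\<le>d - 2. q j * (layer_sum 1 ^^ j) ?w z) + g (\<partial> x z) + h (\<partial> y z))
          * \<tau> (\<partial> z u))" unfolding rel by simp
      also have "\<dots> = (\<Sum>z\<in>UNIV. (\<Sum>j\<le>d - 2. q j * (layer_sum 1 ^^ j) ?w z) * \<tau> (\<partial> z u))
          + G * \<tau> (\<partial> x u) + H * \<tau> (\<partial> y u)"
        unfolding G_def H_def layers[symmetric] by (simp add: distrib_right sum.distrib)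
      also have "(\<Sum>z\<in>UNIV. (\<Sum>j\<le>d - 2. q j * (layer_sum 1 ^^ j) ?w z) * \<tau> (\<partial> z u))
          = (\<Sum>j\<le>d - 2. \<Sum>z\<in>UNIV. q j * ((layer_sum 1 ^^ j) ?w z * \<tau> (\<partial> z u)))"
        unfolding sum_distrib_right mult.assoc by (rule sum.swap)
      also have "\<dots> = Q * W"
        unfolding sum_distrib_left[symmetric] sum_iterate_eigenfunction[OF ef] Q_def W_def
        by (simp add: sum_distrib_right mult.assoc)
      finally have "Q * W = - G * \<tau> (\<partial> x u) - H * \<tau> (\<partial> y u)" by simp
      moreover have "W = (\<Sum>z\<in>\<Gamma> 1 x \<inter> \<Gamma> 1 y. \<tau> (\<partial> z u))"
        unfolding W_def by (intro sum.mono_neutral_cong_right) (auto simp: cell_indicator_def)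
      ultimately show ?thesis using t(3) unfolding Q_def[symmetric] by (simp add: field_simps)
    qed
    show ?thesis
      by (rule dependent_imp_gram_poly_eq_0[OF \<tau> abs_eigenvalue_less[OF nb t(1,2)] xy dep])
  qed
  define Z where "Z = {t. (\<Sum>j\<le>d - 2. q j * t ^ j) = 0}"
  obtain j where j: "q j \<noteq> 0" "j \<le> d - 2" using q by blast
  have Z: "finite Z" "card Z \<le> d - 2"
    unfolding Z_def using polyfun_roots_finite[of q j "d - 2", OF j] polyfun_roots_card[of q j "d - 2", OF j] by auto
  have "card (graph_eigenvalues R - {\<kappa>}) = d"
    using card_eigenvalues valency_is_eigenvalue eigenvalues_at_most(1) by simp
  then have "2 \<le> card (graph_eigenvalues R - {\<kappa>} - Z)"
    using diff_card_le_card_Diff[OF Z(1), of "graph_eigenvalues R - {\<kappa>}"] Z(2) diam by simp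
  then obtain s t where st: "s \<in> graph_eigenvalues R - {\<kappa>} - Z" "t \<in> graph_eigenvalues R - {\<kappa>} - Z" "s < t"
    by (metis card_le_Suc0_iff_eq linorder_less_linear not_less_eq_eq numeral_2_eq_2
        eigenvalues_at_most(1) finite_Diff)
  show ?thesis
    using tight_if_two_zeros[OF a1 xy _ _ _ _ _ _ st(3)] zero[of s] zero[of t] st by (auto simp: Z_def)
qed

end

section \<open>The equivalence\<close>

text \<open>Every edge of a tight graph satisfies \<open>tight_edge\<close> with the eigenvalues \<open>\<theta>\<^sub>1\<close> and \<open>\<theta>\<^sub>d\<close>.\<close>

lemma (in drg) tight_imp_homogeneous:
  assumes tight: "tight R"
  shows "\<partial> x y = 1 \<Longrightarrow> one_homogeneous_wrt R x y" "a_num R d = 0"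
proof -
  have nb: "\<not> bipartite R" using tight unfolding tight_iff by blast
  obtain \<sigma> where \<sigma>: "cosine_sequence (theta R 1) \<sigma>"
    using cosine_sequence_exists theta_1_eigenvalue by blast
  obtain \<rho> where \<rho>: "cosine_sequence (theta R d) \<rho>"
    using cosine_sequence_exists theta_d_eigenvalue by blast
  have edge: "tight_edge R x y (theta R 1) (theta R d) \<sigma> \<rho>" if xy: "\<partial> x y = 1" for x y
  proof unfold_locales
    show "\<bar>theta R 1\<bar> < \<kappa>" "\<bar>theta R d\<bar> < \<kappa>" "theta R 1 \<noteq> theta R d"
      using abs_eigenvalue_less[OF nb] theta_1_eigenvalue theta_d_eigenvalue theta_1_less
        theta_d_less by auto
  qed (use xy \<sigma> \<rho> tight_imp_a1_nonzero[OF tight] tight_imp_gram_poly_eq_0[OF tight xy] in auto)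
  show "one_homogeneous_wrt R x y" if "\<partial> x y = 1"
    by (rule tight_edge.one_homogeneous_edge[OF edge[OF that]])
  obtain u v where "\<partial> u v = 1" using edge_exists by blast
  then show "a_num R d = 0" by (rule tight_edge.a_d_eq_0[OF edge])
qed

theorem theorem11p7:
  fixes R :: "('a::finite) rel" and d :: nat
  assumes "distance_regular R"
    and "d = graph_diameter R"
    and "d \<ge> 3"
  shows "(tight R \<longleftrightarrow> a_num R 1 \<noteq> 0 \<and> a_num R d = 0 \<and> one_homogeneous R) \<and>
         (tight R \<longleftrightarrow> a_num R 1 \<noteq> 0 \<and> a_num R d = 0 \<and>
            (\<exists>x y. (x, y) \<in> R \<and> one_homogeneous_wrt R x y))"
proof -
  interpret drg R using assms by unfold_locales simp_all
  have d: "d = graph_diameter R" by fact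
  have hom: "a_num R 1 \<noteq> 0 \<and> a_num R d = 0 \<and> one_homogeneous R" if "tight R"
    using tight_imp_a1_nonzero[OF that] tight_imp_homogeneous[OF that]
    unfolding one_homogeneous_def d dist_1_iff by blast
  have one: "\<exists>x y. (x, y) \<in> R \<and> one_homogeneous_wrt R x y" if "one_homogeneous R"
    using that edge_exists unfolding one_homogeneous_def dist_1_iff by blast
  have tight: "tight R"
    if "a_num R 1 \<noteq> 0" "a_num R d = 0" "(x, y) \<in> R" "one_homogeneous_wrt R x y" for x y
    using tight_if_homogeneous_edge[of x y] that unfolding d dist_1_iff by blast
  show ?thesis using hom one tight by blast
qed

end
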